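(* Let $b<0$ and put $a=\tfrac{2}{3}(-b)^{3/2}$. Let $$D_I=\{(x,y)\in\mathbb R^2:\ y<0,\ 3(x-a)+2(-y)^{3/2}>0,\ 3(x+a)-2(-y)^{3/2}<0\},$$ and define $E_I(\cdot,\cdot;0,b):\mathbb R^2\to\mathbb R$ by $$E_I(x,y;0,b)=\begin{cases}2^{-1/3}\,E(x,y;0,b) & \text{if }(x,y)\in D_I,\\ 0&\text{elsewhere,}\end{cases}$$ where $E(x,y;0,b)$ is the function given in the context. Then the distribution on $\mathbb R^2$ defined by $E_I$ is a fundamental solution of the Tricomi operator $\mathcal T=y\,\partial_x^2+\partial_y^2$ relative to the point $(0,b)$; that is, $\mathcal T E_I=\delta(x,y-b)$ in the sense of distributions: $\iint_{\mathbb R^2}E_I\,\mathcal T\varphi\,dx\,dy=\varphi(0,b)$ for every $\varphi\in C_c^\infty(\mathbb R^2)$.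
   Context: For $y\le 0$ the characteristic coordinates are $\ell=3x+2(-y)^{3/2}$, $m=3x-2(-y)^{3/2}$. For $b<0$ put $\ell_0=2(-b)^{3/2}=3a$, so that $(0,b)$ has characteristic coordinates $(\ell_0,-\ell_0)$; in these coordinates $D_I=\{\ell>\ell_0,\ m<-\ell_0\}$, the region below the two characteristic curves of $\mathcal T$ issuing from $(0,b)$. At points of $D_I$, $$E(x,y;0,b)=(\ell+\ell_0)^{-1/6}(\ell_0-m)^{-1/6}\,F\!\left(\tfrac16,\tfrac16;1;\zeta\right),\qquad \zeta=\frac{(\ell-\ell_0)(m+\ell_0)}{(\ell+\ell_0)(m-\ell_0)},$$ where $F$ is the Gauss hypergeometric function; on $D_I$ the bases of the powers are positive and $\zeta\in(0,1)$. *)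

theory Defs
  imports "HOL-Analysis.Analysis"
begin

section \<open>Test functions and fundamental solutions of the Tricomi operator\<close>

text \<open>
  \<open>C_k k f\<close> says that \<open>f\<close> is of class $C^k$ on the whole space: all iterated directional
  derivatives of order at most \<open>k\<close> exist and are continuous.
\<close>

fun C_k :: "nat \<Rightarrow> ('a::real_normed_vector \<Rightarrow> 'b::real_normed_vector) \<Rightarrow> bool" where
  "C_k 0 f \<longleftrightarrow> continuous_on UNIV f"
| "C_k (Suc k) f \<longleftrightarrow>
     (\<forall>x. f differentiable (at x)) \<and> (\<forall>v. C_k k (\<lambda>x. frechet_derivative f (at x) v))"

definition test_function :: "('a::real_normed_vector \<Rightarrow> 'b::real_normed_vector) \<Rightarrow> bool" where
  "test_function \<phi> \<longleftrightarrow> (\<forall>k. C_k k \<phi>) \<and> compact (closure {x. \<phi> x \<noteq> 0})"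

definition partial_x :: "(real \<times> real \<Rightarrow> 'b::real_normed_vector) \<Rightarrow> real \<times> real \<Rightarrow> 'b" where
  "partial_x f = (\<lambda>(x, y). vector_derivative (\<lambda>s. f (s, y)) (at x))"

definition partial_y :: "(real \<times> real \<Rightarrow> 'b::real_normed_vector) \<Rightarrow> real \<times> real \<Rightarrow> 'b" where
  "partial_y f = (\<lambda>(x, y). vector_derivative (\<lambda>t. f (x, t)) (at y))"

definition tricomi :: "(real \<times> real \<Rightarrow> 'b::real_normed_vector) \<Rightarrow> real \<times> real \<Rightarrow> 'b" where
  "tricomi f = (\<lambda>(x, y). y *\<^sub>R partial_x (partial_x f) (x, y) + partial_y (partial_y f) (x, y))"

definition locally_integrable :: "(real \<times> real \<Rightarrow> real) \<Rightarrow> bool" where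
  "locally_integrable f \<longleftrightarrow> (\<forall>K. compact K \<longrightarrow> set_integrable lborel K f)"

text \<open>
  Local integrability is what makes \<open>f\<close> define a distribution; without it the (totalised)
  integral below would carry no information. The Tricomi operator is formally self-adjoint, so
  it is also the operator applied to the test function. Test functions are complex-valued.
\<close>

definition tricomi_fundamental_solution :: "(real \<times> real \<Rightarrow> real) \<Rightarrow> real \<times> real \<Rightarrow> bool" where
  "tricomi_fundamental_solution f q \<longleftrightarrow>
     locally_integrable f \<and>
     (\<forall>\<phi> :: real \<times> real \<Rightarrow> complex. test_function \<phi> \<longrightarrow>
        (\<integral>p. f p *\<^sub>R tricomi \<phi> p \<partial>lborel) = \<phi> q)"

section \<open>The function \<open>E_I\<close>\<close>

text \<open>The Gauss hypergeometric series; it represents $F(a,b;c;z)$ for $|z| < 1$.\<close>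

definition hyp2F1 :: "real \<Rightarrow> real \<Rightarrow> real \<Rightarrow> real \<Rightarrow> real" where
  "hyp2F1 a b c z = eval_fps (fps_hypergeo [a, b] [c] 1) z"

text \<open>Characteristic coordinates, meaningful for \<open>y \<le> 0\<close> only.\<close>

definition char_l :: "real \<Rightarrow> real \<Rightarrow> real" where
  "char_l x y = 3 * x + 2 * (- y) powr (3/2)"

definition char_m :: "real \<Rightarrow> real \<Rightarrow> real" where
  "char_m x y = 3 * x - 2 * (- y) powr (3/2)"

text \<open>
  \<open>E_kernel x y b\<close> is $E(x,y;0,b)$. It is only used at points where the bases of the powers are
  positive and the argument of the hypergeometric series lies in $(0,1)$.
\<close>

definition E_kernel :: "real \<Rightarrow> real \<Rightarrow> real \<Rightarrow> real" where
  "E_kernel x y b =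
     (let l = char_l x y; m = char_m x y; l0 = 2 * (- b) powr (3/2) in
      (l + l0) powr (-1/6) * (l0 - m) powr (-1/6) *
      hyp2F1 (1/6) (1/6) 1 (((l - l0) * (m + l0)) / ((l + l0) * (m - l0))))"

definition D_I :: "real \<Rightarrow> (real \<times> real) set" where
  "D_I b = (let a = 2/3 * (- b) powr (3/2) in
     {(x, y). y < 0 \<and> 3 * (x - a) + 2 * (- y) powr (3/2) > 0
                    \<and> 3 * (x + a) - 2 * (- y) powr (3/2) < 0})"

definition E_I :: "real \<Rightarrow> real \<times> real \<Rightarrow> real" where
  "E_I b = (\<lambda>(x, y). if (x, y) \<in> D_I b then 2 powr (-1/3) * E_kernel x y b else 0)"

end

theory Submission
  imports Defs
begin

text \<open>
  The proof is Riemann's method in characteristic coordinates. Where \<open>y < 0\<close> the Tricomi operator is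
  hyperbolic; with the time \<open>t = 2/3 (-y)^(3/2)\<close> its characteristics are \<open>x + t = p\<close> and
  \<open>t - x = q\<close>, and \<open>D_I b\<close> is the quadrant \<open>p > a\<close>, \<open>q > a\<close> with corner \<open>(0, b)\<close>,
  where \<open>a = 2/3 (-b)^(3/2)\<close>. Put
  \<open>w = (-y)^(1/2) = (3 (p + q) / 4)^(1/3)\<close> and let \<open>\<Phi>\<close> be the test function \<open>\<phi>\<close> written in the
  coordinates \<open>(p, q)\<close>. Then
  \<open>E_I (T \<phi>) dx dy = (V \<Phi>_pq + \<kappa> (\<Phi>_p + \<Phi>_q)) dp dq\<close>
  with \<open>V = 2 w E_I\<close> and \<open>\<kappa> = V / (6 (p + q))\<close>, and explicitly
  \<open>V = (p + q)^(1/3) ((p + a) (q + a))^(-1/6) F(\<zeta>)\<close>,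
  \<open>\<zeta> = (p - a) (q - a) / ((p + a) (q + a))\<close>.

  Three properties of \<open>V\<close> make this integral collapse to \<open>\<phi> (0, b)\<close>. First, \<open>V_pq = \<kappa>_p + \<kappa>_q\<close>, which
  is the hypergeometric differential equation for \<open>F\<close> (\<open>riemann_p_has_derivative\<close>). Secondly,
  \<open>V_p = \<kappa>\<close> on the edge \<open>q = a\<close> and, by symmetry, \<open>V_q = \<kappa>\<close> on the edge \<open>p = a\<close>, because \<open>\<zeta>\<close> vanishes
  on both edges (\<open>riemann_transport\<close>). Thirdly, \<open>V = 1\<close> at the corner, which is what the factor
  \<open>2^(-1/3)\<close> in the definition of \<open>E_I\<close> achieves (\<open>riemann_diag\<close>). By the first property the
  integrand is the divergence
  \<open>(V \<Phi>_p + \<kappa> \<Phi>)_q - ((V_q - \<kappa>) \<Phi>)_p\<close>.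
  On the far edges of a large square \<open>\<Phi>\<close> vanishes. The second term contributes nothing on \<open>p = a\<close>
  either, by the second property; the first leaves minus the
  integral of \<open>V \<Phi>_p + V_p \<Phi> = (V \<Phi>)_p\<close> along \<open>q = a\<close>, which is \<open>V \<Phi>\<close> at the corner
  (\<open>riemann_identity\<close>).

  The plane is mapped to the quadrant in two steps: the shear \<open>(x, y) \<mapsto> (p, y)\<close> preserves Lebesgue
  measure (\<open>lborel_shear\<close>), and for fixed \<open>p\<close> the substitution \<open>y \<mapsto> q\<close> is one-dimensional
  (\<open>integral_along_characteristic\<close>).
\<close>

section \<open>The hypergeometric differential equation\<close>

lemma fps_hypergeo_2F1_rec:
  fixes a b c :: real
  assumes "\<And>n. c \<noteq> - of_nat n"
  shows "of_nat (Suc n) * (c + of_nat n) * fps_nth (fps_hypergeo [a, b] [c] 1) (Suc n) =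
         (a + of_nat n) * (b + of_nat n) * fps_nth (fps_hypergeo [a, b] [c] 1) n"
proof -
  have "c + of_nat n \<noteq> 0"
    using assms[of n] by linarith
  then have "of_nat (Suc n) * (c + of_nat n) \<noteq> (0 :: real)"
    by (simp del: of_nat_Suc)
  then show ?thesis
    unfolding fps_hypergeo_rec by (simp del: of_nat_Suc)
qed

text \<open>
  Comparing coefficients of \<open>X^n\<close> turns the differential equation into the two-term recurrence
  above, because \<open>n (n - 1) + (a + b + 1) n + a b = (a + n) (b + n)\<close>.
\<close>

lemma fps_hypergeo_2F1_ODE:
  fixes a b c :: real
  defines "H \<equiv> fps_hypergeo [a, b] [c] 1"
  assumes "\<And>n. c \<noteq> - of_nat n"
  shows "fps_X * (fps_deriv (fps_deriv H) - fps_X * fps_deriv (fps_deriv H)) +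
         (fps_const c * fps_deriv H - fps_const (a + b + 1) * (fps_X * fps_deriv H)) =
         fps_const (a * b) * H" (is "?L = ?R")
proof (rule fps_ext)
  fix n
  have rec: "of_nat (Suc k) * (c + of_nat k) * fps_nth H (Suc k) =
      (a + of_nat k) * (b + of_nat k) * fps_nth H k" for k
    unfolding H_def by (rule fps_hypergeo_2F1_rec) fact
  consider "n = 0" | "n = 1" | k where "n = Suc (Suc k)"
    by (metis One_nat_def not0_implies_Suc)
  then show "fps_nth ?L n = fps_nth ?R n"
    using rec[of n] by cases (simp_all add: algebra_simps)
qed

lemma fps_conv_radius_hypergeo_2F1:
  fixes a b c :: real
  assumes "a > 0" "b > 0" "c > 0"
  shows "fps_conv_radius (fps_hypergeo [a, b] [c] 1) = 1"
  unfolding fps_conv_radius_def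
proof (rule conv_radius_ratio_limit_nonzero[of _ 1])
  let ?f = "fps_nth (fps_hypergeo [a, b] [c] 1)"
  have nz: "?f n \<noteq> 0" for n
    using assms pochhammer_pos[of a n] pochhammer_pos[of b n] pochhammer_pos[of c n]
    by (simp add: less_imp_neq[symmetric])
  have "norm (?f n) / norm (?f (Suc n)) =
      (1 + real n) * (c + real n) / ((a + real n) * (b + real n))" for n
  proof -
    have "norm (?f (Suc n)) =
        (a + real n) * (b + real n) / ((1 + real n) * (c + real n)) * norm (?f n)"
      using assms unfolding fps_hypergeo_rec by (simp add: abs_mult ac_simps)
    then show ?thesis
      using nz[of n] by simp
  qed
  moreover have "(\<lambda>n. (1 + real n) * (c + real n) / ((a + real n) * (b + real n))) \<longlonglongrightarrow> 1"
    using assms by real_asymp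
  ultimately show "(\<lambda>n. norm (?f n) / norm (?f (Suc n))) \<longlonglongrightarrow> 1"
    by simp
qed auto

definition hyp2F1_deriv where
  "hyp2F1_deriv a b c z = eval_fps (fps_deriv (fps_hypergeo [a, b] [c] 1)) (z :: real)"

definition hyp2F1_deriv2 where
  "hyp2F1_deriv2 a b c z = eval_fps (fps_deriv (fps_deriv (fps_hypergeo [a, b] [c] 1))) (z :: real)"

context
  fixes a b c :: real
  assumes pos: "a > 0" "b > 0" "c > 0"
begin

lemma hyp2F1_radii:
  assumes "\<bar>z\<bar> < (1 :: real)"
  shows "norm z < fps_conv_radius (fps_hypergeo [a, b] [c] 1)"
    and "norm z < fps_conv_radius (fps_deriv (fps_hypergeo [a, b] [c] 1))"
    and "norm z < fps_conv_radius (fps_deriv (fps_deriv (fps_hypergeo [a, b] [c] 1)))"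
proof -
  show 1: "norm z < fps_conv_radius (fps_hypergeo [a, b] [c] 1)"
    using assms pos by (simp add: fps_conv_radius_hypergeo_2F1)
  show 2: "norm z < fps_conv_radius (fps_deriv (fps_hypergeo [a, b] [c] 1))"
    using 1 fps_conv_radius_deriv order_less_le_trans by blast
  show "norm z < fps_conv_radius (fps_deriv (fps_deriv (fps_hypergeo [a, b] [c] 1)))"
    using 2 fps_conv_radius_deriv order_less_le_trans by blast
qed

lemma hyp2F1_has_derivatives:
  assumes "\<bar>z\<bar> < 1"
  shows "(hyp2F1 a b c has_real_derivative hyp2F1_deriv a b c z) (at z)"
    and "(hyp2F1_deriv a b c has_real_derivative hyp2F1_deriv2 a b c z) (at z)"
  unfolding hyp2F1_def[abs_def] hyp2F1_deriv_def[abs_def] hyp2F1_deriv2_def[abs_def]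
  by (intro has_field_derivative_eval_fps hyp2F1_radii assms)+

lemma continuous_on_hyp2F1:
  assumes "continuous_on S f" "\<And>x. x \<in> S \<Longrightarrow> \<bar>f x\<bar> < 1"
  shows "continuous_on S (\<lambda>x. hyp2F1 a b c (f x))"
    and "continuous_on S (\<lambda>x. hyp2F1_deriv a b c (f x))"
  unfolding hyp2F1_def[abs_def] hyp2F1_deriv_def[abs_def]
  using hyp2F1_radii assms(2)
  by (auto intro!: continuous_on_eval_fps' assms(1) simp: in_eball_iff)

text \<open>
  Inside the disc of convergence, evaluation of power series is additive and multiplicative, so the
  formal equation can be evaluated at \<open>z\<close>.
\<close>

lemma hyp2F1_ODE:
  assumes z: "\<bar>z\<bar> < 1"
  shows "z * (1 - z) * hyp2F1_deriv2 a b c z + (c - (a + b + 1) * z) * hyp2F1_deriv a b c z =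
         a * b * hyp2F1 a b c z"
proof -
  let ?H = "fps_hypergeo [a, b] [c] 1"
  note r = hyp2F1_radii[OF z]
  have rX: "norm z < fps_conv_radius (fps_X * f)" if "norm z < fps_conv_radius f" for f :: "real fps"
    by (rule order_less_le_trans[OF _ fps_conv_radius_mult]) (use that in auto)
  have rC: "norm z < fps_conv_radius (fps_const k * f)" if "norm z < fps_conv_radius f" for f :: "real fps" and k
    by (rule order_less_le_trans[OF _ fps_conv_radius_mult]) (use that in auto)
  have rD: "norm z < fps_conv_radius (f - g)"
    if "norm z < fps_conv_radius f" "norm z < fps_conv_radius g" for f g :: "real fps"
    by (rule order_less_le_trans[OF _ fps_conv_radius_diff]) (use that in auto)
  have c: "c \<noteq> - real n" for n
    using pos by (smt (verit) of_nat_0_le_iff)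
  have "eval_fps (fps_X * (fps_deriv (fps_deriv ?H) - fps_X * fps_deriv (fps_deriv ?H)) +
         (fps_const c * fps_deriv ?H - fps_const (a + b + 1) * (fps_X * fps_deriv ?H))) z =
        eval_fps (fps_const (a * b) * ?H) z"
    using fps_hypergeo_2F1_ODE[of c a b] c by simp
  then show ?thesis
    unfolding hyp2F1_def hyp2F1_deriv_def hyp2F1_deriv2_def
    by (simp add: eval_fps_add eval_fps_diff eval_fps_mult r rX rC rD del: real_norm_def)
       (simp add: algebra_simps)
qed

end

lemma hyp2F1_0: "hyp2F1 a b c 0 = 1"
  by (simp add: hyp2F1_def eval_fps_at_0)

section \<open>The Riemann function of the Tricomi operator\<close>

definition "char_zeta a p q = (p - a) * (q - a) / ((p + a) * (q + a))" for a p q :: real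

text \<open>
  The function \<open>V = 2 w E_I\<close> in characteristic coordinates; the corner of the quadrant is \<open>(a, a)\<close>.
\<close>

definition riemann where
  "riemann a p q = (p + q) powr (1/3) * ((p + a) * (q + a)) powr (-1/6) *
     hyp2F1 (1/6) (1/6) 1 (char_zeta a p q)" for a p q :: real

text \<open>
  The derivative of \<open>riemann a p q\<close> in \<open>p\<close>. As \<open>riemann\<close> is symmetric, \<open>riemann_p a q p\<close> is its derivative
  in \<open>q\<close>.
\<close>

definition riemann_p where
  "riemann_p a p q = (p + q) powr (1/3) * ((p + a) * (q + a)) powr (-1/6) *
     ((1 / (3 * (p + q)) - 1 / (6 * (p + a))) * hyp2F1 (1/6) (1/6) 1 (char_zeta a p q) +
      2 * a * (q - a) / ((p + a)\<^sup>2 * (q + a)) * hyp2F1_deriv (1/6) (1/6) 1 (char_zeta a p q))" for a p q :: real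

text \<open>
  This is \<open>\<kappa>_p + \<kappa>_q\<close> for \<open>\<kappa> = V / (6 (p + q))\<close>. Calling it the mixed derivative of \<open>V\<close> is justified
  by \<open>riemann_p_has_derivative\<close>, which thereby is the adjoint equation of \<open>V\<close>.
\<close>

definition riemann_pq where
  "riemann_pq a p q = (riemann_p a p q + riemann_p a q p) / (6 * (p + q)) - riemann a p q / (3 * (p + q)\<^sup>2)"

lemma char_zeta_abs_less_1:
  assumes "a > 0" "p \<ge> a" "q \<ge> a"
  shows "\<bar>char_zeta a p q\<bar> < 1"
proof -
  have "(p - a) * (q - a) < (p + a) * (q + a)"
    using assms by (simp add: algebra_simps add_pos_pos)
  moreover have "0 \<le> (p - a) * (q - a)" "0 < (p + a) * (q + a)"
    using assms by auto
  ultimately show ?thesis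
    by (simp add: char_zeta_def)
qed

lemma char_zeta_has_derivative:
  assumes "p + a \<noteq> 0" "q + a \<noteq> 0"
  shows "((\<lambda>p. char_zeta a p q) has_real_derivative 2 * a * (q - a) / ((p + a)\<^sup>2 * (q + a))) (at p)"
  unfolding char_zeta_def
  using assms by (auto intro!: derivative_eq_intros simp: divide_simps power2_eq_square) (simp_all add: algebra_simps)

lemma riemann_commute: "riemann a p q = riemann a q p"
  by (simp add: riemann_def char_zeta_def mult.commute add.commute)

lemma amplitude_has_derivative:
  assumes "a > 0" "p \<ge> a" "q \<ge> a"
  shows "((\<lambda>p. (p + q) powr (1/3) * ((p + a) * (q + a)) powr (-1/6)) has_real_derivative
     (p + q) powr (1/3) * ((p + a) * (q + a)) powr (-1/6) * (1 / (3 * (p + q)) - 1 / (6 * (p + a)))) (at p)"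
proof -
  have s: "p + q > 0" "p + a > 0" "q + a > 0" 
    using assms by auto
  then have t: "(p + a) * (q + a) > 0" by simp
  have d1: "((\<lambda>p. (p + q) powr (1/3)) has_real_derivative (p + q) powr (1/3) * (1 / (3 * (p + q)))) (at p)"
    by (rule DERIV_cong[OF DERIV_powr[of "\<lambda>p. p + q" 1 p "\<lambda>_. 1/3" 0]])
       (use s in \<open>auto intro!: derivative_eq_intros\<close>)
  have d2: "((\<lambda>p. ((p + a) * (q + a)) powr (-1/6)) has_real_derivative ((p + a) * (q + a)) powr (-1/6) * (- 1 / (6 * (p + a)))) (at p)"
    by (rule DERIV_cong[OF DERIV_powr[of "\<lambda>p. (p + a) * (q + a)" "q + a" p "\<lambda>_. -1/6" 0]])
       (use s t in \<open>auto intro!: derivative_eq_intros\<close>)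
  show ?thesis
    by (rule DERIV_cong[OF DERIV_mult[OF d1 d2]]) (simp add: algebra_simps)
qed

lemma riemann_has_derivative:
  assumes "a > 0" "p \<ge> a" "q \<ge> a"
  shows "((\<lambda>p. riemann a p q) has_real_derivative riemann_p a p q) (at p)"
proof -
  have s: "p + a > 0" "q + a > 0" 
    using assms by auto
  have "((\<lambda>p. hyp2F1 (1/6) (1/6) 1 (char_zeta a p q)) has_real_derivative
      hyp2F1_deriv (1/6) (1/6) 1 (char_zeta a p q) * (2 * a * (q - a) / ((p + a)\<^sup>2 * (q + a)))) (at p)"
    using hyp2F1_has_derivatives(1)[OF _ _ _ char_zeta_abs_less_1[OF assms], of "1/6" "1/6" 1]
      char_zeta_has_derivative[of p a q] s
    by (intro DERIV_chain2[where f = "hyp2F1 _ _ _"]) auto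
  from DERIV_mult[OF amplitude_has_derivative[OF assms] this]
  show ?thesis
    unfolding riemann_def riemann_p_def by (rule DERIV_cong) (simp add: algebra_simps)
qed

text \<open>
  The adjoint equation divided by the amplitude \<open>(p + q)^(1/3) ((p + a) (q + a))^(-1/6)\<close>, with
  \<open>F\<close>, \<open>F1\<close>, \<open>F2\<close> in the place of the hypergeometric function and its derivatives at \<open>\<zeta>\<close>. The two
  sides differ by \<open>2 a / ((p + q) (p + a) (q + a))\<close> times the hypergeometric equation.
\<close>

lemma riemann_pde_algebra:
  fixes a p q F F1 F2 :: real
  assumes "a > 0" "p \<ge> a" "q \<ge> a"
  assumes ode: "char_zeta a p q * (1 - char_zeta a p q) * F2 + (1 - 4/3 * char_zeta a p q) * F1 = F / 36"
  shows "(1 / (3 * (p + q)) - 1 / (6 * (p + a))) * ((1 / (3 * (p + q)) - 1 / (6 * (q + a))) * F +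
      2 * a * (p - a) / ((q + a)\<^sup>2 * (p + a)) * F1) +
     (- 1 / (3 * (p + q)\<^sup>2) * F + (1 / (3 * (p + q)) - 1 / (6 * (q + a))) * (F1 * (2 * a * (q - a) / ((p + a)\<^sup>2 * (q + a)))) +
      4 * a\<^sup>2 / ((q + a)\<^sup>2 * (p + a)\<^sup>2) * F1 + 
      2 * a * (p - a) / ((q + a)\<^sup>2 * (p + a)) * (F2 * (2 * a * (q - a) / ((p + a)\<^sup>2 * (q + a))))) =
    (((1 / (3 * (p + q)) - 1 / (6 * (p + a))) * F + 2 * a * (q - a) / ((p + a)\<^sup>2 * (q + a)) * F1) +
     ((1 / (3 * (p + q)) - 1 / (6 * (q + a))) * F + 2 * a * (p - a) / ((q + a)\<^sup>2 * (p + a)) * F1))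
      / (6 * (p + q)) - F / (3 * (p + q)\<^sup>2)"
    (is "?L = ?R")
proof -
  define \<alpha> \<beta> where "\<alpha> = 1 / (3 * (p + q)) - 1 / (6 * (p + a))" "\<beta> = 1 / (3 * (p + q)) - 1 / (6 * (q + a))"
  define zp zq where "zp = 2 * a * (q - a) / ((p + a)\<^sup>2 * (q + a))" "zq = 2 * a * (p - a) / ((q + a)\<^sup>2 * (p + a))"
  define k where "k = 2 * a / ((p + q) * (p + a) * (q + a))"
  have nz: "p + a \<noteq> 0" "q + a \<noteq> 0" "p + q \<noteq> 0"
    using assms by auto
  have 1: "1 - char_zeta a p q = 2 * a * (p + q) / ((p + a) * (q + a))"
    using nz unfolding char_zeta_def by (simp add: divide_simps) algebra
  \<comment> \<open>The coefficients of \<open>F\<close>, \<open>F1\<close> and \<open>F2\<close> in the difference of the two sides.\<close>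
  have c0: "\<alpha> * \<beta> - (\<alpha> + \<beta>) / (6 * (p + q)) = - k / 36"
    using nz unfolding \<alpha>_\<beta>_def k_def by (simp add: divide_simps) algebra
  have c1: "\<alpha> * zq + \<beta> * zp + 4 * a\<^sup>2 / ((q + a)\<^sup>2 * (p + a)\<^sup>2) - (zp + zq) / (6 * (p + q))
      = k * (1 - 4/3 * char_zeta a p q)"
    using nz unfolding \<alpha>_\<beta>_def k_def zp_zq_def char_zeta_def by (simp add: divide_simps) algebra
  have c2: "zp * zq = k * (char_zeta a p q * (1 - char_zeta a p q))"
    using nz unfolding 1 unfolding k_def zp_zq_def char_zeta_def by (simp add: divide_simps) algebra
  have "?L - ?R = (\<alpha> * \<beta> - (\<alpha> + \<beta>) / (6 * (p + q))) * F +
      (\<alpha> * zq + \<beta> * zp + 4 * a\<^sup>2 / ((q + a)\<^sup>2 * (p + a)\<^sup>2) - (zp + zq) / (6 * (p + q))) * F1 + zp * zq * F2"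
    unfolding \<alpha>_\<beta>_def[symmetric] zp_zq_def[symmetric]
    by (simp add: algebra_simps add_divide_distrib)
  also have "\<dots> = k * (char_zeta a p q * (1 - char_zeta a p q) * F2 + (1 - 4/3 * char_zeta a p q) * F1 - F / 36)"
    unfolding c0 c1 c2 by (simp add: algebra_simps)
  also have "\<dots> = 0"
    using ode by simp
  finally show ?thesis by simp
qed

lemma riemann_p_has_derivative:
  assumes "a > 0" "p \<ge> a" "q \<ge> a"
  shows "((\<lambda>p. riemann_p a q p) has_real_derivative riemann_pq a p q) (at p)"
proof -
  have s: "p + a > 0" "q + a > 0" "p + q > 0"
    using assms by auto
  let ?F = "hyp2F1 (1/6) (1/6) 1" and ?F1 = "hyp2F1_deriv (1/6) (1/6) 1" and ?F2 = "hyp2F1_deriv2 (1/6) (1/6) 1"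
  let ?z = "char_zeta a p q"
  let ?zp = "2 * a * (q - a) / ((p + a)\<^sup>2 * (q + a))"
  let ?A = "(p + q) powr (1/3) * ((p + a) * (q + a)) powr (-1/6)"
  let ?\<beta> = "1 / (3 * (p + q)) - 1 / (6 * (q + a))"
  have F: "((\<lambda>p. ?F (char_zeta a p q)) has_real_derivative ?F1 ?z * ?zp) (at p)"
    using hyp2F1_has_derivatives(1)[OF _ _ _ char_zeta_abs_less_1[OF assms], of "1/6" "1/6" 1]
      char_zeta_has_derivative[of p a q] s
    by (intro DERIV_chain2[where f = "hyp2F1 _ _ _"]) auto
  have F1: "((\<lambda>p. ?F1 (char_zeta a p q)) has_real_derivative ?F2 ?z * ?zp) (at p)"
    using hyp2F1_has_derivatives(2)[OF _ _ _ char_zeta_abs_less_1[OF assms], of "1/6" "1/6" 1]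
      char_zeta_has_derivative[of p a q] s
    by (intro DERIV_chain2[where f = "hyp2F1_deriv _ _ _"]) auto
  have \<beta>: "((\<lambda>p. 1 / (3 * (p + q)) - 1 / (6 * (q + a))) has_real_derivative - 1 / (3 * (p + q)\<^sup>2)) (at p)"
    using s by (auto intro!: derivative_eq_intros) (simp add: divide_simps power2_eq_square, algebra)
  have zq: "((\<lambda>p. 2 * a * (p - a) / ((q + a)\<^sup>2 * (p + a))) has_real_derivative
      4 * a\<^sup>2 / ((q + a)\<^sup>2 * (p + a)\<^sup>2)) (at p)"
    using s by (auto intro!: derivative_eq_intros simp: divide_simps power2_eq_square) (simp_all add: algebra_simps)
  have ode: "?z * (1 - ?z) * ?F2 ?z + (1 - 4/3 * ?z) * ?F1 ?z = ?F ?z / 36"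
    using hyp2F1_ODE[of "1/6" "1/6" 1 ?z] char_zeta_abs_less_1[OF assms] by simp
  have eq: "riemann_p a q p = (p + q) powr (1/3) * ((p + a) * (q + a)) powr (-1/6) *
     ((1 / (3 * (p + q)) - 1 / (6 * (q + a))) * ?F (char_zeta a p q) +
      2 * a * (p - a) / ((q + a)\<^sup>2 * (p + a)) * ?F1 (char_zeta a p q))" for p
    by (simp add: riemann_p_def char_zeta_def mult.commute add.commute)
  have "((\<lambda>p. riemann_p a q p) has_real_derivative
     ?A * (1 / (3 * (p + q)) - 1 / (6 * (p + a))) * (?\<beta> * ?F ?z + 2 * a * (p - a) / ((q + a)\<^sup>2 * (p + a)) * ?F1 ?z) +
     (- 1 / (3 * (p + q)\<^sup>2) * ?F ?z + ?F1 ?z * ?zp * ?\<beta> +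
      (4 * a\<^sup>2 / ((q + a)\<^sup>2 * (p + a)\<^sup>2) * ?F1 ?z + ?F2 ?z * ?zp * (2 * a * (p - a) / ((q + a)\<^sup>2 * (p + a))))) * ?A) (at p)"
    unfolding eq
    by (rule DERIV_mult[OF amplitude_has_derivative[OF assms]
          DERIV_add[OF DERIV_mult[OF \<beta> F] DERIV_mult[OF zq F1]]])
  also have "?this \<longleftrightarrow> ?thesis"
  proof (rule arg_cong[where f = "\<lambda>d. (_ has_real_derivative d) (at p)"])
    have aux: "(A * X + A * Y) / d - A * F / e = A * ((X + Y) / d - F / e)" for A X Y F d e :: real
      by (simp add: algebra_simps add_divide_distrib)
    have R: "riemann_pq a p q = ?A * ((((1 / (3 * (p + q)) - 1 / (6 * (p + a))) * ?F ?z + 2 * a * (q - a) / ((p + a)\<^sup>2 * (q + a)) * ?F1 ?z) +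
     ((1 / (3 * (p + q)) - 1 / (6 * (q + a))) * ?F ?z + 2 * a * (p - a) / ((q + a)\<^sup>2 * (p + a)) * ?F1 ?z))
      / (6 * (p + q)) - ?F ?z / (3 * (p + q)\<^sup>2))"
      unfolding riemann_pq_def eq unfolding riemann_def riemann_p_def by (rule aux)
    show "?A * (1 / (3 * (p + q)) - 1 / (6 * (p + a))) * (?\<beta> * ?F ?z + 2 * a * (p - a) / ((q + a)\<^sup>2 * (p + a)) * ?F1 ?z) +
     (- 1 / (3 * (p + q)\<^sup>2) * ?F ?z + ?F1 ?z * ?zp * ?\<beta> +
      (4 * a\<^sup>2 / ((q + a)\<^sup>2 * (p + a)\<^sup>2) * ?F1 ?z + ?F2 ?z * ?zp * (2 * a * (p - a) / ((q + a)\<^sup>2 * (p + a))))) * ?A = riemann_pq a p q"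
      unfolding R riemann_pde_algebra[OF assms ode, symmetric] by algebra
  qed
  finally show ?thesis .
qed

text \<open>
  On the edge \<open>q = a\<close> the argument \<open>\<zeta>\<close> is constantly \<open>0\<close>, so the amplitude alone is differentiated, and
  its logarithmic derivative there is \<open>1 / (3 (p + a)) - 1 / (6 (p + a))\<close>.
\<close>

lemma riemann_transport:
  assumes "a > 0" "p \<ge> a"
  shows "riemann_p a p a = riemann a p a / (6 * (p + a))"
proof -
  have "1 / (3 * (p + a)) - 1 / (6 * (p + a)) = 1 / (6 * (p + a))"
    using assms by (simp add: divide_simps)
  then show ?thesis
    unfolding riemann_def riemann_p_def by simp
qed

lemma riemann_diag:
  assumes "a > 0"
  shows "riemann a a a = 1"
proof -
  have "riemann a a a = (2 * a) powr (1/3) * ((2 * a) powr 2) powr (-1/6)"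
    using assms by (simp add: riemann_def char_zeta_def hyp2F1_0 power2_eq_square)
  also have "\<dots> = 1"
    using assms unfolding powr_powr powr_add[symmetric] by simp
  finally show ?thesis .
qed

lemma continuous_on_riemann:
  fixes f g :: "'a::topological_space \<Rightarrow> real"
  assumes "a > 0" "\<And>x. x \<in> S \<Longrightarrow> f x \<ge> a" "\<And>x. x \<in> S \<Longrightarrow> g x \<ge> a"
    and f: "continuous_on S f" and g: "continuous_on S g"
  shows "continuous_on S (\<lambda>x. riemann a (f x) (g x))"
    and "continuous_on S (\<lambda>x. riemann_p a (f x) (g x))"
    and "continuous_on S (\<lambda>x. riemann_pq a (f x) (g x))"
proof -
  have nz: "f x + a \<noteq> 0 \<and> g x + a \<noteq> 0 \<and> f x + g x \<noteq> 0 \<and> g x + f x \<noteq> 0 \<and> f x + g x > 0" if "x \<in> S" for x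
    using assms(1) assms(2,3)[OF that] by linarith
  have z: "continuous_on S (\<lambda>x. char_zeta a (f x) (g x))"
    unfolding char_zeta_def by (intro continuous_intros f g) (auto dest!: nz)
  have F: "continuous_on S (\<lambda>x. hyp2F1 (1/6) (1/6) 1 (char_zeta a (f x) (g x)))" "continuous_on S (\<lambda>x. hyp2F1_deriv (1/6) (1/6) 1 (char_zeta a (f x) (g x)))"
    using char_zeta_abs_less_1[OF assms(1-3)] by (auto intro!: continuous_on_hyp2F1 z)
  show 1: "continuous_on S (\<lambda>x. riemann a (f x) (g x))"
    unfolding riemann_def by (intro continuous_intros f g F) (auto dest!: nz)
  show 2: "continuous_on S (\<lambda>x. riemann_p a (f x) (g x))"
    unfolding riemann_p_def by (intro continuous_intros f g F) (auto dest!: nz)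
  have z': "continuous_on S (\<lambda>x. char_zeta a (g x) (f x))"
    unfolding char_zeta_def by (intro continuous_intros f g) (auto dest!: nz)
  have F': "continuous_on S (\<lambda>x. hyp2F1 (1/6) (1/6) 1 (char_zeta a (g x) (f x)))" "continuous_on S (\<lambda>x. hyp2F1_deriv (1/6) (1/6) 1 (char_zeta a (g x) (f x)))"
    using char_zeta_abs_less_1[OF assms(1,3,2)] by (auto intro!: continuous_on_hyp2F1 z')
  have 3: "continuous_on S (\<lambda>x. riemann_p a (g x) (f x))"
    unfolding riemann_p_def by (intro continuous_intros f g F') (auto dest!: nz)
  show "continuous_on S (\<lambda>x. riemann_pq a (f x) (g x))"
    unfolding riemann_pq_def by (intro continuous_intros f g 1 2 3) (auto dest!: nz)
qed

section \<open>Riemann's identity on a characteristic square\<close>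

lemma has_vector_derivative_scaleR_at:
  assumes "(f has_real_derivative f') (at t)" "(g has_vector_derivative g') (at t within S)"
  shows "((\<lambda>t. f t *\<^sub>R g t) has_vector_derivative f t *\<^sub>R g' + f' *\<^sub>R g t) (at t within S)"
  using assms(1)[THEN has_field_derivative_at_within] assms(2) by (rule has_vector_derivative_scaleR)

text \<open>
  The integrand is \<open>(V \<Phi>_p + \<kappa> \<Phi>)_q - ((V_q - \<kappa>) \<Phi>)_p\<close> by the adjoint equation. The functions \<open>h\<close> and \<open>dB\<close>
  of the proof are the integrand and the second of these derivatives, so that \<open>h + dB\<close> is integrated by
  the fundamental theorem of calculus in \<open>q\<close>, and \<open>dB\<close>, after a change of the order of
  integration, in \<open>p\<close>. Continuity of \<open>\<Phi>\<close> and its derivatives on the closed square is what allows both.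
  The vanishing on the far edges stands for compact support.
\<close>

lemma riemann_identity:
  fixes \<Phi> \<Phi>p \<Phi>q \<Phi>pq :: "real \<Rightarrow> real \<Rightarrow> 'a::banach"
  assumes a: "a > 0" "a \<le> R"
    and \<Phi>p: "\<And>p q. p \<in> {a..R} \<Longrightarrow> q \<in> {a..R} \<Longrightarrow>
          ((\<lambda>p. \<Phi> p q) has_vector_derivative \<Phi>p p q) (at p within {a..R})"
    and \<Phi>q: "\<And>p q. p \<in> {a..R} \<Longrightarrow> q \<in> {a..R} \<Longrightarrow>
          ((\<lambda>q. \<Phi> p q) has_vector_derivative \<Phi>q p q) (at q within {a..R})"
    and \<Phi>pq: "\<And>p q. p \<in> {a..R} \<Longrightarrow> q \<in> {a..R} \<Longrightarrow>
          ((\<lambda>q. \<Phi>p p q) has_vector_derivative \<Phi>pq p q) (at q within {a..R})"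
    and cont: "continuous_on ({a..R} \<times> {a..R}) (\<lambda>(p, q). \<Phi> p q)"
      "continuous_on ({a..R} \<times> {a..R}) (\<lambda>(p, q). \<Phi>p p q)"
      "continuous_on ({a..R} \<times> {a..R}) (\<lambda>(p, q). \<Phi>q p q)"
      "continuous_on ({a..R} \<times> {a..R}) (\<lambda>(p, q). \<Phi>pq p q)"
    and vanish: "\<And>q. q \<in> {a..R} \<Longrightarrow> \<Phi> R q = 0" "\<And>p. p \<in> {a..R} \<Longrightarrow> \<Phi> p R = 0"
      "\<And>p. p \<in> {a..R} \<Longrightarrow> \<Phi>p p R = 0"
  shows "integral {a..R} (\<lambda>p. integral {a..R} (\<lambda>q. riemann a p q *\<^sub>R \<Phi>pq p q +
           (riemann a p q / (6 * (p + q))) *\<^sub>R (\<Phi>p p q + \<Phi>q p q))) = \<Phi> a a"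
proof -
  define \<kappa> where "\<kappa> p q = riemann a p q / (6 * (p + q))" for p q
  define \<kappa>p where "\<kappa>p p q = riemann_p a p q / (6 * (p + q)) - riemann a p q / (6 * (p + q)\<^sup>2)" for p q
  define h where "h p q = riemann a p q *\<^sub>R \<Phi>pq p q + \<kappa> p q *\<^sub>R (\<Phi>p p q + \<Phi>q p q)" for p q
  define dB where "dB p q = (riemann_p a q p - \<kappa> p q) *\<^sub>R \<Phi>p p q + (riemann_pq a p q - \<kappa>p p q) *\<^sub>R \<Phi> p q" for p q
  have d\<kappa>: "((\<lambda>p. \<kappa> p q) has_real_derivative \<kappa>p p q) (at p)" if "p \<in> {a..R}" "q \<in> {a..R}" for p q
  proof -
    have "p + q \<noteq> 0"
      using a that by auto
    then show ?thesis
      unfolding \<kappa>_def \<kappa>p_def using a that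
      by (auto intro!: derivative_eq_intros riemann_has_derivative simp: divide_simps power2_eq_square, algebra)
  qed
  have \<kappa>_commute: "\<kappa> p q = \<kappa> q p" for p q
    by (simp add: \<kappa>_def riemann_commute[of a p q] add.commute)
  have d\<kappa>': "((\<lambda>q. \<kappa> p q) has_real_derivative \<kappa>p q p) (at q)" if "p \<in> {a..R}" "q \<in> {a..R}" for p q
    using d\<kappa>[OF that(2,1)] by (simp add: \<kappa>_commute[of p])
  have dV': "((\<lambda>q. riemann a p q) has_real_derivative riemann_p a q p) (at q)" if "p \<in> {a..R}" "q \<in> {a..R}" for p q
    using riemann_has_derivative[of a q p] a that by (simp add: riemann_commute[of a p])
  have \<kappa>_sum: "\<kappa>p p q + \<kappa>p q p = riemann_pq a p q" for p q
    unfolding \<kappa>p_def riemann_pq_def by (simp add: riemann_commute[of a p q] add.commute[of q p] add_divide_distrib)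
  have cV: "continuous_on ({a..R} \<times> {a..R}) (\<lambda>x. riemann a (fst x) (snd x))"
    "continuous_on ({a..R} \<times> {a..R}) (\<lambda>x. riemann_p a (fst x) (snd x))"
    "continuous_on ({a..R} \<times> {a..R}) (\<lambda>x. riemann_p a (snd x) (fst x))"
    "continuous_on ({a..R} \<times> {a..R}) (\<lambda>x. riemann_pq a (fst x) (snd x))"
    using a by (auto intro!: continuous_on_riemann continuous_intros)
  have nz: "fst x + snd x \<noteq> 0" if "x \<in> {a..R} \<times> {a..R}" for x
    using that a by auto
  have c\<kappa>: "continuous_on ({a..R} \<times> {a..R}) (\<lambda>x. \<kappa> (fst x) (snd x))"
     "continuous_on ({a..R} \<times> {a..R}) (\<lambda>x. \<kappa>p (fst x) (snd x))"
    unfolding \<kappa>_def \<kappa>p_def using a by (auto intro!: continuous_intros cV dest: nz)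
  note c = cont[unfolded case_prod_unfold]
  have ch: "continuous_on ({a..R} \<times> {a..R}) (\<lambda>x. h (fst x) (snd x))"
    unfolding h_def by (intro continuous_intros cV c\<kappa> c)
  have cdB: "continuous_on ({a..R} \<times> {a..R}) (\<lambda>x. dB (fst x) (snd x))"
    unfolding dB_def by (intro continuous_intros cV c\<kappa> c)
  have sect: "continuous_on {a..R} (\<lambda>q. f p q)"
    if "continuous_on ({a..R} \<times> {a..R}) (\<lambda>x. f (fst x) (snd x))" "p \<in> {a..R}" 
    for p :: real and f :: "real \<Rightarrow> real \<Rightarrow> 'a"
  proof -
    have "continuous_on {a..R} (\<lambda>q. (p, q))"
      by (intro continuous_intros)
    from continuous_on_compose2[OF that(1) this] that(2) show ?thesis
      by (simp add: image_subset_iff)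
  qed
  have param: "continuous_on {a..R} (\<lambda>p. integral {a..R} (f p))"
    if "continuous_on ({a..R} \<times> {a..R}) (\<lambda>x. f (fst x) (snd x))" for f :: "real \<Rightarrow> real \<Rightarrow> 'a"
    using integral_continuous_on_param[of "{a..R}" a R f] that by (simp add: case_prod_unfold)
  \<comment> \<open>On \<open>q = a\<close> the transport equation replaces \<open>\<kappa>\<close> by \<open>V_p\<close>, which creates an exact derivative in \<open>p\<close>.\<close>
  have inner: "integral {a..R} (\<lambda>q. h p q + dB p q) =
      - (riemann a p a *\<^sub>R \<Phi>p p a + riemann_p a p a *\<^sub>R \<Phi> p a)" if p: "p \<in> {a..R}" for p
  proof -
    have "((\<lambda>q. h p q + dB p q) has_integral
        (riemann a p R *\<^sub>R \<Phi>p p R + \<kappa> p R *\<^sub>R \<Phi> p R) - (riemann a p a *\<^sub>R \<Phi>p p a + \<kappa> p a *\<^sub>R \<Phi> p a)) {a..R}"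
    proof (rule fundamental_theorem_of_calculus[OF a(2)])
      fix q assume q: "q \<in> {a..R}"
      have "((\<lambda>q. riemann a p q *\<^sub>R \<Phi>p p q + \<kappa> p q *\<^sub>R \<Phi> p q) has_vector_derivative
        (riemann a p q *\<^sub>R \<Phi>pq p q + riemann_p a q p *\<^sub>R \<Phi>p p q) + (\<kappa> p q *\<^sub>R \<Phi>q p q + \<kappa>p q p *\<^sub>R \<Phi> p q)) (at q within {a..R})"
        by (intro has_vector_derivative_add has_vector_derivative_scaleR_at dV' d\<kappa>' \<Phi>pq \<Phi>q p q)
      also have "(riemann a p q *\<^sub>R \<Phi>pq p q + riemann_p a q p *\<^sub>R \<Phi>p p q) + (\<kappa> p q *\<^sub>R \<Phi>q p q + \<kappa>p q p *\<^sub>R \<Phi> p q) = h p q + dB p q"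
        unfolding h_def dB_def \<kappa>_sum[symmetric] by (simp add: algebra_simps)
      finally show "((\<lambda>q. riemann a p q *\<^sub>R \<Phi>p p q + \<kappa> p q *\<^sub>R \<Phi> p q) has_vector_derivative
        h p q + dB p q) (at q within {a..R})" .
    qed
    then show ?thesis
      using vanish(2,3)[OF p] riemann_transport[of a p] a p by (simp add: integral_unique \<kappa>_def)
  qed
  have outer: "integral {a..R} (\<lambda>p. riemann a p a *\<^sub>R \<Phi>p p a + riemann_p a p a *\<^sub>R \<Phi> p a) = - \<Phi> a a"
  proof -
    have "((\<lambda>p. riemann a p a *\<^sub>R \<Phi>p p a + riemann_p a p a *\<^sub>R \<Phi> p a) has_integral
        (riemann a R a *\<^sub>R \<Phi> R a - riemann a a a *\<^sub>R \<Phi> a a)) {a..R}"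
      by (rule fundamental_theorem_of_calculus[OF a(2)])
         (use a in \<open>auto intro!: has_vector_derivative_scaleR_at riemann_has_derivative \<Phi>p\<close>)
    then show ?thesis
      using vanish(1)[of a] a by (simp add: integral_unique riemann_diag)
  qed
  have "integral {a..R} (\<lambda>p. integral {a..R} (dB p)) = integral {a..R} (\<lambda>q. integral {a..R} (\<lambda>p. dB p q))"
    using integral_swap_continuous[of a a R R dB] cdB by (simp add: case_prod_unfold cbox_Pair_eq)
  also have "\<dots> = integral {a..R} (\<lambda>q. 0)"
  proof (rule integral_cong)
    fix q assume q: "q \<in> {a..R}"
    have "((\<lambda>p. dB p q) has_integral
        ((riemann_p a q R - \<kappa> R q) *\<^sub>R \<Phi> R q - (riemann_p a q a - \<kappa> a q) *\<^sub>R \<Phi> a q)) {a..R}"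
      unfolding dB_def
      by (rule fundamental_theorem_of_calculus[OF a(2)])
         (use a q in \<open>auto intro!: has_vector_derivative_scaleR_at riemann_p_has_derivative d\<kappa> \<Phi>p DERIV_diff\<close>)
    moreover have "riemann_p a q a = \<kappa> a q"
      using riemann_transport[of a q] a q by (simp add: \<kappa>_def riemann_commute[of a a q] add.commute)
    ultimately show "integral {a..R} (\<lambda>p. dB p q) = 0"
      using vanish(1)[OF q] by (simp add: integral_unique)
  qed
  finally have zero: "integral {a..R} (\<lambda>p. integral {a..R} (dB p)) = 0"
    by simp
  have "integral {a..R} (\<lambda>p. integral {a..R} (h p)) =
      integral {a..R} (\<lambda>p. integral {a..R} (\<lambda>q. h p q + dB p q) - integral {a..R} (dB p))"
    by (rule integral_cong) (simp add: integral_add integrable_continuous_interval sect[OF ch] sect[OF cdB])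
  also have "\<dots> = integral {a..R} (\<lambda>p. integral {a..R} (\<lambda>q. h p q + dB p q)) - integral {a..R} (\<lambda>p. integral {a..R} (dB p))"
    by (intro integral_diff integrable_continuous_interval param continuous_intros ch cdB)
  also have "\<dots> = integral {a..R} (\<lambda>p. - (riemann a p a *\<^sub>R \<Phi>p p a + riemann_p a p a *\<^sub>R \<Phi> p a))"
    unfolding zero diff_zero by (rule integral_cong) (rule inner)
  also have "\<dots> = \<Phi> a a"
    unfolding integral_neg outer by simp
  finally show ?thesis
    unfolding h_def \<kappa>_def .
qed

section \<open>Partial derivatives of smooth functions\<close>

lemma C_k_imp_continuous_on: "C_k k f \<Longrightarrow> continuous_on UNIV f"
  by (cases k) (auto intro!: continuous_at_imp_continuous_on differentiable_imp_continuous_within)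

lemma has_derivative_imp_partials:
  assumes "(f has_derivative D) (at z)"
  shows "partial_x f z = D (1, 0)" "partial_y f z = D (0, 1)"
proof -
  obtain x y where z: "z = (x, y)"
    by (cases z)
  note f = assms[unfolded z]
  have "((\<lambda>s. (s, y)) has_derivative (\<lambda>h. (h, 0))) (at x)"
    by (intro has_derivative_Pair has_derivative_ident has_derivative_const)
  from has_derivative_compose[OF this f]
  have "((\<lambda>s. f (s, y)) has_derivative (\<lambda>h. D (h, 0))) (at x)" .
  moreover have scale: "(\<lambda>h. h *\<^sub>R D (1, 0)) = (\<lambda>h. D (h, 0))"
    using linear_scale[OF has_derivative_linear[OF f], of _ "(1, 0)", symmetric] by simp
  ultimately have "((\<lambda>s. f (s, y)) has_vector_derivative D (1, 0)) (at x)"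
    unfolding has_vector_derivative_def scale by simp
  then show "partial_x f z = D (1, 0)"
    unfolding z partial_x_def prod.case by (rule vector_derivative_at)
  have "((\<lambda>t. (x, t)) has_derivative (\<lambda>h. (0, h))) (at y)"
    by (intro has_derivative_Pair has_derivative_ident has_derivative_const)
  from has_derivative_compose[OF this f]
  have "((\<lambda>t. f (x, t)) has_derivative (\<lambda>h. D (0, h))) (at y)" .
  moreover have scale: "(\<lambda>h. h *\<^sub>R D (0, 1)) = (\<lambda>h. D (0, h))"
    using linear_scale[OF has_derivative_linear[OF f], of _ "(0, 1)", symmetric] by simp
  ultimately have "((\<lambda>t. f (x, t)) has_vector_derivative D (0, 1)) (at y)"
    unfolding has_vector_derivative_def scale by simp
  then show "partial_y f z = D (0, 1)"
    unfolding z partial_y_def prod.case by (rule vector_derivative_at)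
qed

lemma C_k_Suc_has_derivative:
  assumes "C_k (Suc k) f"
  shows "(f has_derivative (\<lambda>h. fst h *\<^sub>R partial_x f z + snd h *\<^sub>R partial_y f z)) (at z)"
proof -
  let ?D = "frechet_derivative f (at z)"
  have D: "(f has_derivative ?D) (at z)"
    using assms unfolding C_k.simps frechet_derivative_works by blast
  have "?D h = fst h *\<^sub>R partial_x f z + snd h *\<^sub>R partial_y f z" for h
  proof -
    have "?D h = ?D (fst h *\<^sub>R (1, 0) + snd h *\<^sub>R (0, 1))"
      by simp
    also have "\<dots> = fst h *\<^sub>R ?D (1, 0) + snd h *\<^sub>R ?D (0, 1)"
      by (simp only: linear_add[OF has_derivative_linear[OF D]] linear_scale[OF has_derivative_linear[OF D]])
    finally show ?thesis
      by (simp add: has_derivative_imp_partials[OF D])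
  qed
  then have "?D = (\<lambda>h. fst h *\<^sub>R partial_x f z + snd h *\<^sub>R partial_y f z)"
    by (rule ext)
  from D[unfolded this] show ?thesis .
qed

lemma C_k_Suc_partials:
  assumes "C_k (Suc k) f"
  shows "C_k k (partial_x f)" "C_k k (partial_y f)"
proof -
  have D: "(f has_derivative frechet_derivative f (at z)) (at z)" for z
    using assms unfolding C_k.simps frechet_derivative_works by blast
  have "partial_x f = (\<lambda>z. frechet_derivative f (at z) (1, 0))"
    "partial_y f = (\<lambda>z. frechet_derivative f (at z) (0, 1))"
    by (rule ext, rule has_derivative_imp_partials[OF D])+
  then show "C_k k (partial_x f)" "C_k k (partial_y f)"
    using assms unfolding C_k.simps by auto
qed

lemma C_k_Suc_vector_derivative:
  assumes "C_k (Suc k) f"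
    and "(u has_real_derivative u') (at t within S)" "(v has_real_derivative v') (at t within S)"
  shows "((\<lambda>t. f (u t, v t)) has_vector_derivative
     u' *\<^sub>R partial_x f (u t, v t) + v' *\<^sub>R partial_y f (u t, v t)) (at t within S)"
proof -
  have "((\<lambda>t. (u t, v t)) has_derivative (\<lambda>h. (u' * h, v' * h))) (at t within S)"
    using assms(2,3) unfolding has_field_derivative_def by (rule has_derivative_Pair)
  from has_derivative_compose[OF this C_k_Suc_has_derivative[OF assms(1)]]
  show ?thesis
    unfolding has_vector_derivative_def fst_conv snd_conv scaleR_add_right scaleR_scaleR
    by (simp only: mult.commute)
qed

lemma partials_eq_0_outside_support:
  assumes "\<And>w. w \<notin> K \<Longrightarrow> f w = 0" "closed K" "z \<notin> K"
  shows "partial_x f z = 0" "partial_y f z = 0"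
proof -
  have "(f has_derivative (\<lambda>_. 0)) (at z)"
    by (rule has_derivative_transform_within_open[where s = "- K" and f = "\<lambda>_. 0"])
       (use assms in auto)
  from has_derivative_imp_partials[OF this] show "partial_x f z = 0" "partial_y f z = 0"
    by auto
qed

text \<open>
  Symmetry of second derivatives for continuously differentiable partial derivatives, via
  differentiation under the integral sign: writing \<open>f (x, y)\<close> as \<open>f (x, c)\<close> plus the integral of
  \<open>\<partial>_y f\<close> from \<open>c\<close> to \<open>y\<close>, differentiate in \<open>x\<close> under the integral and then in the upper limit \<open>y\<close>.
\<close>

lemma partial_x_partial_y_commute:
  fixes f :: "real \<times> real \<Rightarrow> 'b::banach"
  assumes "C_k (Suc (Suc k)) f"
  shows "partial_x (partial_y f) = partial_y (partial_x f)"
proof (rule ext, clarify)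
  fix x y :: real
  \<comment> \<open>Any base point below \<open>y\<close> will do; it keeps \<open>y\<close> away from the lower limit of integration.\<close>
  define c where "c = y - 1"
  note f = C_k_Suc_vector_derivative[OF assms]
  note fx = C_k_Suc_vector_derivative[OF C_k_Suc_partials(1)[OF assms]]
  note fy = C_k_Suc_vector_derivative[OF C_k_Suc_partials(2)[OF assms]]
  have cont: "continuous_on UNIV (partial_y f)" "continuous_on UNIV (partial_x (partial_y f))"
    using C_k_Suc_partials[OF assms] C_k_Suc_partials(1)[OF C_k_Suc_partials(2)[OF assms]]
    by (blast intro: C_k_imp_continuous_on)+
  have int: "f (x', y') = f (x', c) + integral {c..y'} (\<lambda>t. partial_y f (x', t))" if "c \<le> y'" for x' y'
  proof -
    have "((\<lambda>t. partial_y f (x', t)) has_integral f (x', y') - f (x', c)) {c..y'}"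
      using f[of "\<lambda>_. x'" 0 _ _ "\<lambda>t. t" 1]
      by (intro fundamental_theorem_of_calculus that) auto
    then show ?thesis
      by (simp add: integral_unique)
  qed
  have px: "partial_x f (x, y') = partial_x f (x, c) + integral {c..y'} (\<lambda>t. partial_x (partial_y f) (x, t))"
    if "c \<le> y'" for y'
  proof -
    have "((\<lambda>x. integral (cbox c y') (\<lambda>t. partial_y f (x, t))) has_vector_derivative
        integral (cbox c y') (\<lambda>t. partial_x (partial_y f) (x, t))) (at x within UNIV)"
    proof (rule leibniz_rule_vector_derivative)
      show "((\<lambda>x. partial_y f (x, t)) has_vector_derivative partial_x (partial_y f) (x', t)) (at x' within UNIV)" for x' t
        using fy[of "\<lambda>x. x" 1 _ _ "\<lambda>_. t" 0] by simp
      show "(\<lambda>t. partial_y f (x', t)) integrable_on cbox c y'" for x'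
        by (intro integrable_continuous continuous_on_compose2[OF cont(1)] continuous_intros) auto
      show "continuous_on (UNIV \<times> cbox c y') (\<lambda>(x, t). partial_x (partial_y f) (x, t))"
        using continuous_on_subset[OF cont(2)] by (simp add: case_prod_unfold)
    qed auto
    moreover have "((\<lambda>x. f (x, c)) has_vector_derivative partial_x f (x, c)) (at x)"
      using f[of "\<lambda>x. x" 1 _ _ "\<lambda>_. c" 0] by simp
    ultimately have "((\<lambda>x. f (x, y')) has_vector_derivative
        partial_x f (x, c) + integral {c..y'} (\<lambda>t. partial_x (partial_y f) (x, t))) (at x)"
      using int[OF that] by (auto intro!: has_vector_derivative_add)
    moreover have "((\<lambda>x. f (x, y')) has_vector_derivative partial_x f (x, y')) (at x)"
      using f[of "\<lambda>x. x" 1 _ _ "\<lambda>_. y'" 0] by simp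
    ultimately show ?thesis
      using vector_derivative_unique_at by blast
  qed
  have "((\<lambda>y'. partial_x f (x, c) + integral {c..y'} (\<lambda>t. partial_x (partial_y f) (x, t))) has_vector_derivative
      partial_x (partial_y f) (x, y)) (at y within {c..y+1})"
  proof -
    have "continuous_on {c..y+1} (\<lambda>t. partial_x (partial_y f) (x, t))"
      by (intro continuous_on_compose2[OF cont(2)] continuous_intros) auto
    from integral_has_vector_derivative[OF this, of y] show ?thesis
      by (auto intro!: derivative_eq_intros simp: c_def)
  qed
  then have 1: "((\<lambda>y'. partial_x f (x, y')) has_vector_derivative partial_x (partial_y f) (x, y)) (at y within {c..y+1})"
  proof (rule has_vector_derivative_transform[rotated 2])
    show "partial_x f (x, y') = partial_x f (x, c) + integral {c..y'} (\<lambda>t. partial_x (partial_y f) (x, t))"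
      if "y' \<in> {c..y+1}" for y'
      using that by (intro px) simp
  qed (simp add: c_def)
  have 2: "((\<lambda>y'. partial_x f (x, y')) has_vector_derivative partial_y (partial_x f) (x, y)) (at y within {c..y+1})"
    using fx[of "\<lambda>_. x" 0 _ _ "\<lambda>t. t" 1] by simp
  show "partial_x (partial_y f) (x, y) = partial_y (partial_x f) (x, y)"
    by (rule vector_derivative_unique_within_closed_interval[of c "y + 1" y, OF _ _ 1[folded box_real] 2[folded box_real]])
       (simp_all add: c_def)
qed

section \<open>Characteristic coordinates\<close>

text \<open>
  The time \<open>t\<close>, truncated to \<open>0\<close> where \<open>y \<ge> 0\<close>. The truncation makes it continuous on the whole line and
  hence usable in a shear of the whole plane.
\<close>

definition "char_time y = 2/3 * (max 0 (- y)) powr (3/2)" for y :: real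

text \<open>
  The inverse coordinate change \<open>(p, q) \<mapsto> (x, y)\<close>, with \<open>char_w p q\<close> equal to \<open>(-y)^(1/2)\<close>, the speed of
  propagation.
\<close>

definition "char_w p q = (3 * (p + q) / 4) powr (1/3)" for p q :: real
definition "char_x p q = (p - q) / 2" for p q :: real
definition "char_y p q = - (char_w p q)\<^sup>2" for p q :: real

lemma continuous_on_char_time [continuous_intros]:
  "continuous_on S f \<Longrightarrow> continuous_on S (\<lambda>x. char_time (f x))"
  unfolding char_time_def by (intro continuous_intros continuous_on_powr') auto

lemma char_time_measurable [measurable]: "char_time \<in> borel_measurable borel"
  by (intro borel_measurable_continuous_onI continuous_intros)

lemma char_w_pos: "p + q > 0 \<Longrightarrow> char_w p q > 0"
  by (simp add: char_w_def)

lemma char_w_commute: "char_w p q = char_w q p"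
  by (simp add: char_w_def add.commute)

lemma char_w_cube: "p + q > 0 \<Longrightarrow> char_w p q ^ 3 = 3 * (p + q) / 4"
  by (simp add: char_w_def powr_power)

lemma char_y_powr:
  assumes "p + q > 0"
  shows "(- char_y p q) powr (3/2) = 3 * (p + q) / 4"
proof -
  have "(- char_y p q) powr (3/2) = (((3 * (p + q) / 4) powr (1/3)) powr 2) powr (3/2)"
    using assms by (simp add: char_y_def char_w_def)
  also have "\<dots> = (3 * (p + q) / 4) powr 1"
    by (simp only: powr_powr) simp
  finally show ?thesis
    using assms by simp
qed

lemma char_time_char_y:
  assumes "p + q > 0"
  shows "char_time (char_y p q) = (p + q) / 2"
proof -
  have "max 0 (- char_y p q) = - char_y p q"
    by (simp add: char_y_def)
  then show ?thesis
    using char_y_powr[OF assms] by (simp add: char_time_def)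
qed

lemma char_x_char_y_char_time:
  assumes "y < 0"
  shows "char_x (x + char_time y) (char_time y - x) = x" "char_y (x + char_time y) (char_time y - x) = y"
proof -
  have "char_w (x + char_time y) (char_time y - x) = ((- y) powr (3/2)) powr (1/3)"
    using assms by (simp add: char_w_def char_time_def)
  then show "char_y (x + char_time y) (char_time y - x) = y"
    using assms by (simp add: char_y_def powr_powr powr_power)
qed (simp add: char_x_def)

lemma char_time_pos_iff: "char_time y > 0 \<longleftrightarrow> y < 0"
  by (auto simp: char_time_def max_def)

text \<open>
  Differentiating \<open>w^3 = 3 (p + q) / 4\<close> gives \<open>3 w^2 w_q = 3/4\<close>. The same relation lets \<open>p + q\<close> be expressed
  by \<open>w\<close>, after which all the formulas below are rational in \<open>w\<close>.
\<close>

lemma char_w_has_derivative: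
  assumes "p + q > 0"
  shows "((\<lambda>q. char_w p q) has_real_derivative 1 / (4 * (char_w p q)\<^sup>2)) (at q)"
proof -
  have pos: "3 * (p + q) / 4 > 0"
    using assms by simp
  have w: "char_w p q > 0"
    using assms by (rule char_w_pos)
  have "((\<lambda>q. char_w p q) has_real_derivative char_w p q * (1 / (3 * (p + q)))) (at q)"
    unfolding char_w_def
    by (rule DERIV_cong[OF DERIV_powr[of "\<lambda>q. 3 * (p + q) / 4" "3/4" q "\<lambda>_. 1/3" 0]])
       (use pos in \<open>auto intro!: derivative_eq_intros\<close>)
  also have "p + q = 4 / 3 * char_w p q ^ 3"
    using char_w_cube[OF assms] by simp
  also have "char_w p q * (1 / (3 * (4 / 3 * char_w p q ^ 3))) = 1 / (4 * (char_w p q)\<^sup>2)"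
    using w by (simp add: power2_eq_square power3_eq_cube)
  finally show ?thesis .
qed

lemma char_y_has_derivative:
  assumes "p + q > 0"
  shows "((\<lambda>q. char_y p q) has_real_derivative - 1 / (2 * char_w p q)) (at q)"
    and "((\<lambda>p. char_y p q) has_real_derivative - 1 / (2 * char_w p q)) (at p)"
proof -
  have 1: "((\<lambda>q. char_y p q) has_real_derivative - 1 / (2 * char_w p q)) (at q)" if "p + q > 0" for p q
    unfolding char_y_def using char_w_pos[OF that]
    by (auto intro!: derivative_eq_intros char_w_has_derivative that simp: power2_eq_square)
  show "((\<lambda>q. char_y p q) has_real_derivative - 1 / (2 * char_w p q)) (at q)"
    by (rule 1[OF assms])
  show "((\<lambda>p. char_y p q) has_real_derivative - 1 / (2 * char_w p q)) (at p)"
    using 1[of q p] assms by (simp add: char_y_def char_w_commute[of q] add.commute)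
qed

lemma continuous_on_char_w [continuous_intros]:
  assumes "continuous_on S f" "continuous_on S g" "\<And>x. x \<in> S \<Longrightarrow> f x + g x > 0"
  shows "continuous_on S (\<lambda>x. char_w (f x) (g x))" "continuous_on S (\<lambda>x. char_y (f x) (g x))"
proof -
  have nz: "3 * (f x + g x) / 4 \<noteq> 0" if "x \<in> S" for x
    using assms(3)[OF that] by (intro less_imp_neq[symmetric]) simp
  show "continuous_on S (\<lambda>x. char_w (f x) (g x))"
    unfolding char_w_def by (intro continuous_intros assms ballI nz) simp
  then show "continuous_on S (\<lambda>x. char_y (f x) (g x))"
    unfolding char_y_def by (intro continuous_intros)
qed

lemma continuous_on_char_x [continuous_intros]:
  "continuous_on S f \<Longrightarrow> continuous_on S g \<Longrightarrow> continuous_on S (\<lambda>x. char_x (f x) (g x))"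
  unfolding char_x_def by (intro continuous_intros) auto

lemma char_y_strict_antimono:
  assumes "p + q > 0" "q < q'"
  shows "char_y p q' < char_y p q"
proof -
  have "char_w p q < char_w p q'"
    unfolding char_w_def using assms by (intro powr_less_mono2) auto
  then have "(char_w p q)\<^sup>2 < (char_w p q')\<^sup>2"
    using char_w_pos[OF assms(1)] by (intro power_strict_mono) auto
  then show ?thesis
    by (simp add: char_y_def)
qed

text \<open>
  A function \<open>\<phi>\<close> of \<open>(x, y)\<close> written in characteristic coordinates, followed by the values that the
  chain rule gives for its derivatives in \<open>p\<close>, in \<open>q\<close>, and in both. The mixed partial derivatives of
  \<open>\<phi>\<close> cancel in the last one.
\<close>

definition pull where
  "pull \<phi> p q = \<phi> (char_x p q, char_y p q)" for \<phi> :: "real \<times> real \<Rightarrow> 'b::banach"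

definition pull_p where
  "pull_p \<phi> p q = (1/2) *\<^sub>R partial_x \<phi> (char_x p q, char_y p q) -
     (1 / (2 * char_w p q)) *\<^sub>R partial_y \<phi> (char_x p q, char_y p q)"
  for \<phi> :: "real \<times> real \<Rightarrow> 'b::banach"

definition pull_q where
  "pull_q \<phi> p q = - (1/2) *\<^sub>R partial_x \<phi> (char_x p q, char_y p q) -
     (1 / (2 * char_w p q)) *\<^sub>R partial_y \<phi> (char_x p q, char_y p q)"
  for \<phi> :: "real \<times> real \<Rightarrow> 'b::banach"

definition pull_pq where
  "pull_pq \<phi> p q =
     (1 / (4 * (char_w p q)\<^sup>2)) *\<^sub>R (partial_y (partial_y \<phi>) (char_x p q, char_y p q) -
       (char_w p q)\<^sup>2 *\<^sub>R partial_x (partial_x \<phi>) (char_x p q, char_y p q)) +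
     (1 / (8 * char_w p q ^ 4)) *\<^sub>R partial_y \<phi> (char_x p q, char_y p q)"
  for \<phi> :: "real \<times> real \<Rightarrow> 'b::banach"

text \<open>
  The Tricomi operator in characteristic coordinates: as \<open>y = -w^2\<close>, the second order part of
  \<open>pull_pq\<close> is that of \<open>T \<phi> / (4 w^2)\<close>, and its first order part is cancelled by
  \<open>\<Phi>_p + \<Phi>_q = - (1 / w) \<phi>_y\<close>, because \<open>6 (p + q) w = 8 w^4\<close>.
\<close>

lemma tricomi_characteristic:
  fixes \<phi> :: "real \<times> real \<Rightarrow> 'b::banach" and p q :: real
  assumes pq: "p + q > 0"
  shows "V *\<^sub>R pull_pq \<phi> p q + (V / (6 * (p + q))) *\<^sub>R (pull_p \<phi> p q + pull_q \<phi> p q) =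
     (V / (4 * (char_w p q)\<^sup>2)) *\<^sub>R tricomi \<phi> (char_x p q, char_y p q)"
proof -
  define P w where "P = (char_x p q, char_y p q)" and "w = char_w p q"
  have w: "w > 0"
    unfolding w_def using pq by (rule char_w_pos)
  have s: "p + q = 4 / 3 * w ^ 3"
    unfolding w_def using char_w_cube[OF pq] by simp
  have "(V / (6 * (p + q))) *\<^sub>R (((1/2) *\<^sub>R partial_x \<phi> P - (1 / (2 * w)) *\<^sub>R partial_y \<phi> P) +
         (- (1/2) *\<^sub>R partial_x \<phi> P - (1 / (2 * w)) *\<^sub>R partial_y \<phi> P)) = 
     (V / (6 * (p + q)) * (- 2 / (2 * w))) *\<^sub>R partial_y \<phi> P"
  proof -
    have "u - v + (- (1/2) *\<^sub>R x - v) = (- 2) *\<^sub>R v" if "u = (1/2) *\<^sub>R x" for u v x :: 'b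
      by (simp add: that scaleR_2)
    from this[OF refl] show ?thesis
      by simp
  qed
  also have "V / (6 * (p + q)) * (- 2 / (2 * w)) = - V / (8 * w ^ 4)"
    unfolding s using w by (simp add: field_simps power3_eq_cube power4_eq_xxxx)
  finally have 1: "(V / (6 * (p + q))) *\<^sub>R (((1/2) *\<^sub>R partial_x \<phi> P - (1 / (2 * w)) *\<^sub>R partial_y \<phi> P) +
         (- (1/2) *\<^sub>R partial_x \<phi> P - (1 / (2 * w)) *\<^sub>R partial_y \<phi> P)) = (- V / (8 * w ^ 4)) *\<^sub>R partial_y \<phi> P" .
  have 2: "tricomi \<phi> P = partial_y (partial_y \<phi>) P - w\<^sup>2 *\<^sub>R partial_x (partial_x \<phi>) P"
    unfolding tricomi_def P_def w_def by (simp add: char_y_def)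
  show ?thesis
    unfolding pull_p_def pull_q_def pull_pq_def P_def[symmetric] w_def[symmetric] 1 2
    by (simp add: scaleR_add_right)
qed

lemma C_2_pull_has_derivatives:
  fixes \<phi> :: "real \<times> real \<Rightarrow> 'b::banach"
  assumes \<phi>: "C_k 2 \<phi>" and pq: "p + q > 0"
  shows "((\<lambda>p. pull \<phi> p q) has_vector_derivative pull_p \<phi> p q) (at p within S)"
    and "((\<lambda>q. pull \<phi> p q) has_vector_derivative pull_q \<phi> p q) (at q within S)"
    and "((\<lambda>q. pull_p \<phi> p q) has_vector_derivative pull_pq \<phi> p q) (at q within S)"
proof -
  have \<phi>2: "C_k (Suc (Suc 0)) \<phi>"
    using \<phi> by (simp only: numeral_2_eq_2)
  note x = C_k_Suc_partials(1)[OF \<phi>2] and y = C_k_Suc_partials(2)[OF \<phi>2]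
  have w: "char_w p q > 0"
    using pq by (rule char_w_pos)
  have X: "((\<lambda>p. char_x p q) has_real_derivative 1/2) (at p within S)"
    "((\<lambda>q. char_x p q) has_real_derivative - 1/2) (at q within S)"
    unfolding char_x_def by (auto intro!: derivative_eq_intros)
  note Y = char_y_has_derivative[OF pq, THEN has_field_derivative_at_within]
  show "((\<lambda>p. pull \<phi> p q) has_vector_derivative pull_p \<phi> p q) (at p within S)"
    unfolding pull_def pull_p_def using C_k_Suc_vector_derivative[OF \<phi>2 X(1) Y(2)] by simp
  show "((\<lambda>q. pull \<phi> p q) has_vector_derivative pull_q \<phi> p q) (at q within S)"
    unfolding pull_def pull_q_def using C_k_Suc_vector_derivative[OF \<phi>2 X(2) Y(1)] by simp
  have dw: "((\<lambda>q. 1 / (2 * char_w p q)) has_real_derivative - 1 / (8 * char_w p q ^ 4)) (at q)"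
    using w by (auto intro!: derivative_eq_intros char_w_has_derivative pq simp: power2_eq_square power4_eq_xxxx)
  have "((\<lambda>q. pull_p \<phi> p q) has_vector_derivative
      (1/2) *\<^sub>R ((- 1/2) *\<^sub>R partial_x (partial_x \<phi>) (char_x p q, char_y p q) + (- 1 / (2 * char_w p q)) *\<^sub>R partial_y (partial_x \<phi>) (char_x p q, char_y p q))
       - ((1 / (2 * char_w p q)) *\<^sub>R ((- 1/2) *\<^sub>R partial_x (partial_y \<phi>) (char_x p q, char_y p q) + (- 1 / (2 * char_w p q)) *\<^sub>R partial_y (partial_y \<phi>) (char_x p q, char_y p q))
          + (- 1 / (8 * char_w p q ^ 4)) *\<^sub>R partial_y \<phi> (char_x p q, char_y p q))) (at q within S)"
    unfolding pull_p_def
    by (intro has_vector_derivative_diff has_vector_derivative_scaleR_at dw bounded_linear.has_vector_derivative[OF bounded_linear_scaleR_right]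
        C_k_Suc_vector_derivative[OF x X(2) Y(1)] C_k_Suc_vector_derivative[OF y X(2) Y(1)])
  also have "(1/2) *\<^sub>R ((- 1/2) *\<^sub>R partial_x (partial_x \<phi>) (char_x p q, char_y p q) + (- 1 / (2 * char_w p q)) *\<^sub>R partial_y (partial_x \<phi>) (char_x p q, char_y p q))
       - ((1 / (2 * char_w p q)) *\<^sub>R ((- 1/2) *\<^sub>R partial_x (partial_y \<phi>) (char_x p q, char_y p q) + (- 1 / (2 * char_w p q)) *\<^sub>R partial_y (partial_y \<phi>) (char_x p q, char_y p q))
          + (- 1 / (8 * char_w p q ^ 4)) *\<^sub>R partial_y \<phi> (char_x p q, char_y p q)) = pull_pq \<phi> p q"
    unfolding pull_pq_def partial_x_partial_y_commute[OF \<phi>2] using w by (simp add: algebra_simps power2_eq_square)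
  finally show "((\<lambda>q. pull_p \<phi> p q) has_vector_derivative pull_pq \<phi> p q) (at q within S)" .
qed

section \<open>Invariance of Lebesgue measure under shears\<close>

text \<open>
  By Tonelli it suffices to integrate in \<open>x\<close> for each fixed \<open>y\<close>, where the shear is a translation.
\<close>

lemma lborel_shear:
  fixes s :: "real \<Rightarrow> real"
  assumes [measurable]: "s \<in> borel_measurable borel"
  shows "distr lborel borel (\<lambda>(x, y). (x - s y, y)) = (lborel :: (real \<times> real) measure)"
proof (rule measure_eqI)
  fix A :: "(real \<times> real) set" assume "A \<in> sets (distr lborel borel (\<lambda>(x, y). (x - s y, y)))"
  then have A[measurable]: "A \<in> sets (borel \<Otimes>\<^sub>M borel)"
    unfolding borel_prod by simp
  then have A': "A \<in> sets borel"
    unfolding borel_prod .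
  have T[measurable]: "(\<lambda>(x, y). (x - s y, y)) \<in> measurable (borel \<Otimes>\<^sub>M borel) (borel \<Otimes>\<^sub>M borel)"
    by measurable
  have "emeasure (distr lborel borel (\<lambda>(x, y). (x - s y, y))) A =
      (\<integral>\<^sup>+z. indicator A z \<partial>distr (lborel \<Otimes>\<^sub>M lborel) (borel \<Otimes>\<^sub>M borel) (\<lambda>(x, y). (x - s y, y)))"
    using A unfolding lborel_prod borel_prod by simp
  also have "\<dots> = (\<integral>\<^sup>+z. indicator A (fst z - s (snd z), snd z) \<partial>(lborel \<Otimes>\<^sub>M lborel))"
    by (subst nn_integral_distr) (auto simp: case_prod_unfold)
  also have "\<dots> = (\<integral>\<^sup>+y. \<integral>\<^sup>+x. indicator A (x - s y, y) \<partial>lborel \<partial>lborel)"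
    by (subst lborel_pair.nn_integral_snd[symmetric]) auto
  also have "\<dots> = (\<integral>\<^sup>+y. \<integral>\<^sup>+x. indicator A (x, y) \<partial>lborel \<partial>lborel)"
  proof (rule nn_integral_cong)
    fix y
    show "(\<integral>\<^sup>+x. indicator A (x - s y, y) \<partial>lborel) = (\<integral>\<^sup>+x. indicator A (x, y) \<partial>lborel)"
      by (subst (2) nn_integral_real_affine[where c = 1 and t = "- s y"]) auto
  qed
  also have "\<dots> = emeasure lborel A"
    by (subst lborel_pair.nn_integral_snd) (simp_all add: lborel_prod borel_prod A' borel_measurable_indicator[OF A'])
  finally show "emeasure (distr lborel borel (\<lambda>(x, y). (x - s y, y))) A = emeasure lborel A" .
qed simp

lemma integral_lborel_shear:
  fixes s :: "real \<Rightarrow> real" and f :: "real \<times> real \<Rightarrow> 'a::{banach, second_countable_topology}"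
  assumes s[measurable]: "s \<in> borel_measurable borel" and f: "integrable lborel f"
  shows "(\<integral>z. f z \<partial>lborel) = (\<integral>p. (\<integral>y. f (p - s y, y) \<partial>lborel) \<partial>lborel)"
proof -
  let ?T = "\<lambda>(x, y). (x - s y, y)"
  have "?T \<in> measurable (borel \<Otimes>\<^sub>M borel) (borel \<Otimes>\<^sub>M borel)"
    by measurable
  then have T: "?T \<in> measurable lborel borel"
    by (simp add: borel_prod)
  have fm: "f \<in> borel_measurable borel"
    using f by auto
  have "integrable lborel (\<lambda>z. f (?T z))"
    using f fm T by (subst integrable_distr_eq[symmetric]) (auto simp: lborel_shear)
  then have "integrable (lborel \<Otimes>\<^sub>M lborel) (\<lambda>z. f (?T z))"
    by (simp add: lborel_prod)
  from lborel_pair.integral_fst'[OF this]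
  have "(\<integral>p. (\<integral>y. f (p - s y, y) \<partial>lborel) \<partial>lborel) = (\<integral>z. f (?T z) \<partial>lborel)"
    by (simp add: lborel_prod)
  also have "\<dots> = (\<integral>z. f z \<partial>distr lborel borel ?T)"
    by (rule integral_distr[symmetric, OF T fm])
  finally show ?thesis
    by (simp add: lborel_shear)
qed

section \<open>The fundamental solution\<close>

text \<open>
  Adding the two inequalities gives \<open>t > a > 0\<close>, which contains the condition \<open>y < 0\<close>.
\<close>

lemma D_I_characteristic:
  assumes "b < 0" and a_def: "a = 2/3 * (- b) powr (3/2)"
  shows "D_I b = {z. a < fst z + char_time (snd z) \<and> a < char_time (snd z) - fst z}"
proof -
  have "(y < 0 \<and> 0 < 3 * (x - a) + 2 * (- y) powr (3/2) \<and> 3 * (x + a) - 2 * (- y) powr (3/2) < 0)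
      \<longleftrightarrow> a < x + char_time y \<and> a < char_time y - x" if "a > 0" for x y a
  proof (cases "y < 0")
    case True
    then have "2 * (- y) powr (3/2) = 3 * char_time y"
      by (simp add: char_time_def)
    with True show ?thesis
      by auto
  next
    case False
    then have "char_time y = 0"
      by (simp add: char_time_def)
    with False that show ?thesis
      by auto
  qed
  note key = this
  have "a > 0"
    unfolding a_def using assms(1) by simp
  then show ?thesis
    unfolding D_I_def Let_def a_def[symmetric] by (auto simp only: key case_prod_unfold)
qed

text \<open>
  Here \<open>\<ell> = 3 p\<close>, \<open>m = - 3 q\<close> and \<open>\<ell>_0 = 3 a\<close>, so the argument of the series is \<open>\<zeta>\<close>, and the powers agree up
  to a constant that is \<open>1\<close> because \<open>2^(-1/3) 9^(-1/6) = 6^(-1/3)\<close> and \<open>2 (3/4)^(1/3) = 6^(1/3)\<close>.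
\<close>

lemma E_kernel_characteristic:
  assumes "b < 0" and a_def: "a = 2/3 * (- b) powr (3/2)" and pq: "p \<ge> a" "q \<ge> a"
  shows "2 powr (-1/3) * E_kernel (char_x p q) (char_y p q) b = riemann a p q / (2 * char_w p q)"
proof -
  have a: "a > 0"
    unfolding a_def using assms(1) by simp
  have l: "char_l (char_x p q) (char_y p q) = 3 * p" "char_m (char_x p q) (char_y p q) = - 3 * q"
    unfolding char_l_def char_m_def using a pq by (simp_all add: char_y_powr char_x_def field_simps)
  have z: "(3 * p - 3 * a) * (- 3 * q + 3 * a) / ((3 * p + 3 * a) * (- 3 * q - 3 * a)) = char_zeta a p q"
    using a pq by (simp add: char_zeta_def divide_simps) algebra
  have "2 powr (-1/3) * E_kernel (char_x p q) (char_y p q) b =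
     2 powr (-1/3) * ((3 * p + 3 * a) powr (-1/6) * (3 * a + 3 * q) powr (-1/6)) * hyp2F1 (1/6) (1/6) 1 (char_zeta a p q)"
    unfolding E_kernel_def Let_def l z[symmetric] by (simp add: a_def)
  also have "2 powr (-1/3) * ((3 * p + 3 * a) powr (-1/6) * (3 * a + 3 * q) powr (-1/6)) =
      (p + q) powr (1/3) * ((p + a) * (q + a)) powr (-1/6) / (2 * char_w p q)"
  proof -
    have n: "2 powr (-1/3) * ((9::real) powr (-1/6)) * (2 * (3/4) powr (1/3)) = 1"
    proof -
      have "(2::real) = 8 powr (1/3)" 
        using powr_powr[of "2::real" 3 "1/3"] by simp
      moreover have "(9::real) powr (-1/6) = 3 powr (-1/3)"
        using powr_powr[of "3::real" 2 "-1/6"] by simp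
      ultimately have "2 powr (-1/3) * ((9::real) powr (-1/6)) * (2 * (3/4) powr (1/3)) =
          2 powr (-1/3) * (3 powr (-1/3)) * (8 powr (1/3) * (3/4) powr (1/3))"
        by simp
      also have "\<dots> = 6 powr (-1/3) * 6 powr (1/3)"
        unfolding powr_mult[symmetric] by simp
      also have "\<dots> = 1"
        unfolding powr_add[symmetric] by simp
      finally show ?thesis .
    qed
    have "(3 * p + 3 * a) powr (-1/6) * (3 * a + 3 * q) powr (-1/6) = (9 * ((p + a) * (q + a))) powr (-1/6)"
      unfolding powr_mult[symmetric] by (simp add: algebra_simps)
    also have "\<dots> = 9 powr (-1/6) * ((p + a) * (q + a)) powr (-1/6)"
      by (rule powr_mult)
    finally have 1: "(3 * p + 3 * a) powr (-1/6) * (3 * a + 3 * q) powr (-1/6) = 9 powr (-1/6) * ((p + a) * (q + a)) powr (-1/6)" .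
    have 2: "char_w p q = (3/4) powr (1/3) * (p + q) powr (1/3)"
      unfolding char_w_def powr_mult[symmetric] by simp
    have "(p + q) powr (1/3) \<noteq> 0"
      using a pq by simp
    then show ?thesis
      unfolding 1 2 using n by (simp add: field_simps)
  qed
  finally show ?thesis
    by (simp add: riemann_def)
qed

lemma E_I_on_D_I:
  assumes "b < 0" and a_def: "a = 2/3 * (- b) powr (3/2)"
  shows "E_I b z = indicator (D_I b) z *
     (riemann a (fst z + char_time (snd z)) (char_time (snd z) - fst z) /
       (2 * char_w (fst z + char_time (snd z)) (char_time (snd z) - fst z)))"
proof (cases "z \<in> D_I b")
  case True
  obtain x y where z: "z = (x, y)"
    by (cases z)
  have pq: "a < x + char_time y" "a < char_time y - x"
    using True unfolding D_I_characteristic[OF assms] z by auto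
  have "a > 0"
    unfolding a_def using assms(1) by simp
  then have "y < 0"
    using pq char_time_pos_iff[of y] by linarith
  then show ?thesis
    using True E_kernel_characteristic[OF assms less_imp_le[OF pq(1)] less_imp_le[OF pq(2)]]
    by (simp add: E_I_def z char_x_char_y_char_time)
qed (cases z; simp add: E_I_def)

text \<open>
  \<open>E_I b\<close> is the restriction to the open set \<open>D_I b\<close> of a function that is continuous on the closed
  quadrant \<open>p \<ge> a\<close>, \<open>q \<ge> a\<close>; there \<open>0 \<le> \<zeta> < 1\<close>, so the series causes no singularity on the boundary.
\<close>

lemma set_integrable_E_I:
  fixes \<psi> :: "real \<times> real \<Rightarrow> 'a::euclidean_space"
  assumes b: "b < 0" and \<psi>: "continuous_on UNIV \<psi>" and K: "compact K"
  shows "set_integrable lborel K (\<lambda>z. E_I b z *\<^sub>R \<psi> z)"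
proof -
  define a where "a = 2/3 * (- b) powr (3/2)"
  have a: "a > 0"
    unfolding a_def using b by simp
  define C where "C = {z. a \<le> fst z + char_time (snd z) \<and> a \<le> char_time (snd z) - fst z}"
  define G where "G z = riemann a (fst z + char_time (snd z)) (char_time (snd z) - fst z) /
       (2 * char_w (fst z + char_time (snd z)) (char_time (snd z) - fst z))" for z
  have "closed C"
    unfolding C_def by (intro closed_Collect_conj closed_Collect_le continuous_intros)
  then have KC: "compact (K \<inter> C)"
    using K by (simp add: compact_Int_closed)
  have pos: "fst z + char_time (snd z) + (char_time (snd z) - fst z) > 0" if "z \<in> K \<inter> C" for z
    using that a unfolding C_def by auto
  have "continuous_on (K \<inter> C) G"
    unfolding G_def
    by (intro continuous_on_divide continuous_on_mult continuous_on_const continuous_on_riemann continuous_on_char_w a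
        continuous_intros pos)
       (use pos char_w_pos in \<open>auto simp: C_def less_imp_neq[symmetric]\<close>)
  then have cont: "continuous_on (K \<inter> C) (\<lambda>z. G z *\<^sub>R \<psi> z)"
    using continuous_on_subset[OF \<psi>] by (intro continuous_intros) auto
  have "set_integrable lborel (K \<inter> C) (\<lambda>z. G z *\<^sub>R \<psi> z)"
    unfolding set_integrable_def by (rule borel_integrable_compact[OF KC cont])
  moreover have "open (D_I b)"
    unfolding D_I_characteristic[OF b a_def] by (intro open_Collect_conj open_Collect_less continuous_intros)
  then have "K \<inter> D_I b \<in> sets lborel"
    using K by (simp add: borel_compact borel_open sets.Int)
  moreover have "D_I b \<subseteq> C"
    unfolding D_I_characteristic[OF b a_def] C_def by auto
  ultimately have "set_integrable lborel (K \<inter> D_I b) (\<lambda>z. G z *\<^sub>R \<psi> z)"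
    by (auto intro: set_integrable_subset)
  also have "?this \<longleftrightarrow> ?thesis"
    unfolding set_integrable_def G_def
    by (intro arg_cong[where f = "integrable lborel"] ext)
       (simp add: E_I_on_D_I[OF b a_def] indicator_inter_arith algebra_simps)
  finally show ?thesis .
qed

lemma locally_integrable_E_I:
  assumes "b < 0"
  shows "locally_integrable (E_I b)"
  unfolding locally_integrable_def
  using set_integrable_E_I[OF assms, of "\<lambda>_. 1 :: real"] by simp

text \<open>
  The substitution \<open>y = char_y p q\<close> along the characteristic \<open>x + t = p\<close>. It contributes the factor
  \<open>1 / (2 w)\<close> next to the \<open>1 / (2 w)\<close> in \<open>E_I = V / (2 w)\<close>. As \<open>y\<close> decreases in \<open>q\<close>, the interval
  \<open>a < q < R\<close> corresponds to \<open>char_y p R < y < char_y p a\<close>.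
\<close>

lemma integral_along_characteristic:
  fixes \<psi> :: "real \<times> real \<Rightarrow> 'a::euclidean_space"
  assumes b: "b < 0" and a_def: "a = 2/3 * (- b) powr (3/2)"
    and \<psi>: "continuous_on UNIV \<psi>"
    and p: "a < p" and R: "a \<le> R"
    and vanish: "\<And>q. q \<ge> R \<Longrightarrow> \<psi> (char_x p q, char_y p q) = 0"
  shows "(\<integral>y. E_I b (p - char_time y, y) *\<^sub>R \<psi> (p - char_time y, y) \<partial>lborel) =
     integral {a..R} (\<lambda>q. (riemann a p q / (4 * (char_w p q)\<^sup>2)) *\<^sub>R \<psi> (char_x p q, char_y p q))"
proof -
  have a: "a > 0"
    unfolding a_def using b by simp
  \<comment> \<open>The integrand without the cut-off to \<open>D_I b\<close>, so that it is continuous up to \<open>q = a\<close>.\<close>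
  define k where "k y = (riemann a p (2 * char_time y - p) / (2 * char_w p (2 * char_time y - p))) *\<^sub>R \<psi> (p - char_time y, y)" for y
  let ?I = "{char_y p R<..<char_y p a}" and ?J = "{char_y p R..char_y p a}"
  have q_of_y: "2 * char_time (char_y p q) - p = q" if "q \<ge> a" for q
    using char_time_char_y[of p q] that p a by simp
  have y_of_q: "char_y p (2 * char_time y - p) = y" if "y < 0" for y
    using char_x_char_y_char_time(2)[OF that, of "p - char_time y"] by simp
  have char_y_mono: "char_y p q' < char_y p q \<longleftrightarrow> q < q'" if "q \<ge> a" "q' \<ge> a" for q q'
    using char_y_strict_antimono[of p q q'] char_y_strict_antimono[of p q' q] that p a by (cases q q' rule: linorder_cases) auto
  have char_y_mono': "char_y p q' \<le> char_y p q \<longleftrightarrow> q \<le> q'" if "q \<ge> a" "q' \<ge> a" for q q'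
    using char_y_mono[OF that(2,1)] by linarith
  have char_y_neg: "char_y p q < 0" if "q \<ge> a" for q
    using char_w_pos[of p q] that p a by (simp add: char_y_def)
  have range: "a \<le> 2 * char_time y - p \<and> 2 * char_time y - p \<le> R \<and> y < 0" if "y \<in> ?J" for y
  proof -
    have y: "y < 0"
      using that char_y_neg[of a] by auto
    moreover have "char_time (char_y p a) \<le> char_time y" "char_time y \<le> char_time (char_y p R)"
      using that y char_y_neg[of R] R unfolding char_time_def by (auto intro!: powr_mono2)
    ultimately show ?thesis
      using q_of_y[of a] q_of_y[of R] R by simp
  qed
  have k_at_y: "k (char_y p q) = (riemann a p q / (2 * char_w p q)) *\<^sub>R \<psi> (char_x p q, char_y p q)" if "q \<ge> a" for q
  proof -
    have "p - char_time (char_y p q) = char_x p q"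
      using char_time_char_y[of p q] that p a by (simp add: char_x_def field_simps)
    then show ?thesis
      by (simp add: k_def q_of_y[OF that])
  qed
  have *: "E_I b (p - char_time y, y) *\<^sub>R \<psi> (p - char_time y, y) = indicator ?I y *\<^sub>R k y" for y
  proof (cases "a < 2 * char_time y - p")
    case True
    then have y: "y < 0"
      using p a char_time_pos_iff[of y] by linarith
    define q where "q = 2 * char_time y - p"
    have q: "a < q" "char_y p q = y" "char_x p q = p - char_time y"
      using True y_of_q[OF y] by (auto simp: q_def char_x_def)
    have "E_I b (p - char_time y, y) *\<^sub>R \<psi> (p - char_time y, y) = k y"
      using True p by (simp add: E_I_on_D_I[OF b a_def] D_I_characteristic[OF b a_def] k_def)
    moreover have "y \<in> ?I \<longleftrightarrow> q < R"
      using char_y_mono[of q R] char_y_mono[of a q] q R by auto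
    moreover have "k y = 0" if "\<not> q < R"
      using vanish[of q] k_at_y[of q] q that by simp
    ultimately show ?thesis
      by (auto simp: indicator_def)
  next
    case False
    then have "E_I b (p - char_time y, y) = 0"
      by (simp add: E_I_on_D_I[OF b a_def] D_I_characteristic[OF b a_def])
    moreover have "y \<notin> ?I"
    proof
      assume y: "y \<in> ?I"
      then have "y < 0"
        using char_y_neg[of a] by auto
      have "y = char_y p (2 * char_time y - p)"
        using y_of_q[OF \<open>y < 0\<close>] by simp
      with y False range[of y] show False
        by auto
    qed
    ultimately show ?thesis
      by simp
  qed
  have k_cont: "continuous_on ?J k"
  proof -
    have 1: "continuous_on ?J (\<lambda>y. riemann a p (2 * char_time y - p))"
      using range p by (intro continuous_on_riemann a continuous_intros) auto
    have 2: "continuous_on ?J (\<lambda>y. char_w p (2 * char_time y - p))"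
      using range p a by (intro continuous_intros) force+
    have 3: "char_w p (2 * char_time y - p) \<noteq> 0" if "y \<in> ?J" for y
      using range[OF that] p a char_w_pos[of p "2 * char_time y - p"] by simp
    have 4: "continuous_on ?J (\<lambda>y. \<psi> (p - char_time y, y))"
      by (intro continuous_on_compose2[OF \<psi>] continuous_intros) auto
    show ?thesis
      unfolding k_def
      by (intro continuous_on_scaleR continuous_on_divide continuous_on_mult continuous_on_const 1 2 4)
         (use 3 in auto)
  qed
  have sub: "char_y p ` {a..R} \<subseteq> ?J"
    using char_y_mono' by auto
  have "set_integrable lborel ?J k"
    unfolding set_integrable_def by (rule borel_integrable_compact[OF compact_Icc k_cont])
  then have "set_integrable lborel ?I k"
    by (rule set_integrable_subset) auto
  from set_borel_integral_eq_integral(2)[OF this]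
  have "(\<integral>y. E_I b (p - char_time y, y) *\<^sub>R \<psi> (p - char_time y, y) \<partial>lborel) = integral ?I k"
    unfolding * set_lebesgue_integral_def .
  also have "\<dots> = integral ?J k"
    by (simp add: integral_open_interval_real)
  also have "\<dots> = integral {a..R} (\<lambda>q. (riemann a p q / (4 * (char_w p q)\<^sup>2)) *\<^sub>R \<psi> (char_x p q, char_y p q))"
  proof -
    have "((\<lambda>q. (- 1 / (2 * char_w p q)) *\<^sub>R k (char_y p q)) has_integral
        (integral {char_y p a..char_y p R} k - integral ?J k)) {a..R}"
    proof (rule has_integral_substitution_general[OF finite.emptyI R sub k_cont])
      show "continuous_on {a..R} (char_y p)"
        using p a by (intro continuous_on_char_w continuous_intros) auto
      show "(char_y p has_real_derivative - 1 / (2 * char_w p q)) (at q within {a..R})" if "q \<in> {a..R} - {}" for q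
        using char_y_has_derivative(1)[of p q] that p a by (auto intro: has_field_derivative_at_within)
    qed
    moreover have "integral {char_y p a..char_y p R} k = 0"
      using char_y_mono[of a R] R by (cases "a = R") auto
    ultimately have "((\<lambda>q. (- 1 / (2 * char_w p q)) *\<^sub>R k (char_y p q)) has_integral - integral ?J k) {a..R}"
      by simp
    from has_integral_neg[OF this]
    have "((\<lambda>q. (1 / (2 * char_w p q)) *\<^sub>R k (char_y p q)) has_integral integral ?J k) {a..R}"
      by simp
    then have "((\<lambda>q. (riemann a p q / (4 * (char_w p q)\<^sup>2)) *\<^sub>R \<psi> (char_x p q, char_y p q)) has_integral integral ?J k) {a..R}"
      by (rule has_integral_eq[rotated]) (simp add: k_at_y power2_eq_square)
    then show ?thesis
      by (simp add: integral_unique)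
  qed
  finally show ?thesis .
qed

text \<open>
  With \<open>R\<close> so large that \<open>\<phi>\<close> vanishes where \<open>p \<ge> R\<close> or \<open>q \<ge> R\<close>, the integral over the plane is one
  over the square \<open>a \<le> p, q \<le> R\<close>, to which Riemann's identity applies.
\<close>

lemma E_I_tricomi_integral:
  fixes \<phi> :: "real \<times> real \<Rightarrow> 'a::euclidean_space"
  assumes b: "b < 0" and \<phi>: "C_k 2 \<phi>" and supp: "compact (closure {z. \<phi> z \<noteq> 0})"
  shows "(\<integral>z. E_I b z *\<^sub>R tricomi \<phi> z \<partial>lborel) = \<phi> (0, b)"
proof -
  define a where "a = 2/3 * (- b) powr (3/2)"
  have a: "a > 0"
    unfolding a_def using b by simp
  define K where "K = closure {z. \<phi> z \<noteq> 0}"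
  have K: "compact K" "closed K"
    using supp by (simp_all add: K_def)
  have \<phi>2: "C_k (Suc (Suc 0)) \<phi>"
    using \<phi> by (simp only: numeral_2_eq_2)
  note x = C_k_Suc_partials(1)[OF \<phi>2] and y = C_k_Suc_partials(2)[OF \<phi>2]
  note conts = \<phi>2[THEN C_k_imp_continuous_on] x[THEN C_k_imp_continuous_on] y[THEN C_k_imp_continuous_on]
    C_k_Suc_partials(1)[OF x, THEN C_k_imp_continuous_on] C_k_Suc_partials(2)[OF y, THEN C_k_imp_continuous_on]
  have tri: "tricomi \<phi> = (\<lambda>z. snd z *\<^sub>R partial_x (partial_x \<phi>) z + partial_y (partial_y \<phi>) z)"
    by (simp add: tricomi_def case_prod_unfold)
  have cont: "continuous_on UNIV (tricomi \<phi>)"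
    unfolding tri by (intro continuous_intros conts)
  have zero: "\<phi> z = 0" if "z \<notin> K" for z
    using that closure_subset[of "{z. \<phi> z \<noteq> 0}"] by (auto simp: K_def)
  have zero1: "partial_x \<phi> z = 0" "partial_y \<phi> z = 0" if "z \<notin> K" for z
    using partials_eq_0_outside_support[OF zero K(2) that] by auto
  have zero2: "partial_x (partial_x \<phi>) z = 0" "partial_y (partial_y \<phi>) z = 0" if "z \<notin> K" for z
    using partials_eq_0_outside_support(1)[OF zero1(1) K(2) that]
      partials_eq_0_outside_support(2)[OF zero1(2) K(2) that] by auto
  have tri_zero: "tricomi \<phi> z = 0" if "z \<notin> K" for z
    using that by (simp add: tri zero2)
  obtain M where M: "\<And>z. z \<in> K \<Longrightarrow> norm z \<le> M" "M \<ge> 1"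
    using compact_imp_bounded[OF K(1)] unfolding bounded_iff by (meson max.cobounded1 max.cobounded2 order_trans)
  \<comment> \<open>If \<open>p\<close> or \<open>q\<close> is at least \<open>R\<close>, then \<open>w^3 = 3 (p + q) / 4 > M^3\<close>, and \<open>\<bar>y\<bar> = w^2 > w > M\<close> leaves the support.\<close>
  define R where "R = a + 2 * M ^ 3"
  have R: "a < R"
    using M(2) by (simp add: R_def)
  have far: "(char_x p q, char_y p q) \<notin> K" if "p \<ge> a" "q \<ge> a" "p \<ge> R \<or> q \<ge> R" for p q
  proof
    assume "(char_x p q, char_y p q) \<in> K"
    from M(1)[OF this] have "(char_w p q)\<^sup>2 \<le> M"
      using norm_snd_le[of "char_y p q" "char_x p q"] by (simp add: char_y_def)
    moreover have "M ^ 3 < char_w p q ^ 3"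
    proof -
      have "M ^ 3 < 3 * (p + q) / 4"
        using that a M(2) unfolding R_def by auto
      then show ?thesis
        using char_w_cube[of p q] that a by simp
    qed
    then have "M < char_w p q"
      using that a char_w_pos[of p q] by (intro power_less_imp_less_base[of M 3]) auto
    moreover have "char_w p q < (char_w p q)\<^sup>2"
      using \<open>M < char_w p q\<close> M(2) by (simp add: power2_eq_square)
    ultimately show False
      by simp
  qed
  define J where "J p = integral {a..R} (\<lambda>q. (riemann a p q / (4 * (char_w p q)\<^sup>2)) *\<^sub>R tricomi \<phi> (char_x p q, char_y p q))" for p
  have "indicator K z *\<^sub>R (E_I b z *\<^sub>R tricomi \<phi> z) = E_I b z *\<^sub>R tricomi \<phi> z" for z
    using tri_zero[of z] by (cases "z \<in> K") auto
  then have int: "integrable lborel (\<lambda>z. E_I b z *\<^sub>R tricomi \<phi> z)"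
    using set_integrable_E_I[OF b cont K(1)] by (simp only: set_integrable_def)
  have slice: "(\<integral>y. E_I b (p - char_time y, y) *\<^sub>R tricomi \<phi> (p - char_time y, y) \<partial>lborel) = indicator {a<..<R} p *\<^sub>R J p" for p
  proof (cases "a < p")
    case True
    have "(\<integral>y. E_I b (p - char_time y, y) *\<^sub>R tricomi \<phi> (p - char_time y, y) \<partial>lborel) = J p"
      unfolding J_def using True R
      by (intro integral_along_characteristic[OF b a_def cont True] tri_zero far) auto
    moreover have "J p = 0" if "p \<ge> R"
    proof -
      have "J p = integral {a..R} (\<lambda>q. 0)"
        unfolding J_def using that True by (intro integral_cong) (auto simp: tri_zero far)
      then show ?thesis
        by simp
    qed
    ultimately show ?thesis
      using True by (auto simp: indicator_def)
  next
    case False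
    then have "E_I b (p - char_time y, y) = 0" for y
      by (simp add: E_I_on_D_I[OF b a_def] D_I_characteristic[OF b a_def])
    with False show ?thesis
      by simp
  qed
  have cP: "continuous_on ({a..R} \<times> {a..R}) (\<lambda>z. f (char_x (fst z) (snd z), char_y (fst z) (snd z)))"
    if "continuous_on UNIV f" for f :: "real \<times> real \<Rightarrow> 'a"
    using a by (intro continuous_on_compose2[OF that] continuous_intros) auto
  have cwc: "continuous_on ({a..R} \<times> {a..R}) (\<lambda>z. char_w (fst z) (snd z))"
    using a by (intro continuous_intros) auto
  have cw0: "\<forall>z\<in>{a..R} \<times> {a..R}. char_w (fst z) (snd z) \<noteq> 0"
    using a by (auto simp: less_imp_neq[OF char_w_pos, symmetric])
  have J_cont: "continuous_on {a..R} J"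
  proof -
    have "continuous_on ({a..R} \<times> {a..R}) (\<lambda>z. riemann a (fst z) (snd z))"
      using a by (intro continuous_on_riemann continuous_intros) auto
    then have "continuous_on ({a..R} \<times> {a..R}) (\<lambda>z. (riemann a (fst z) (snd z) / (4 * (char_w (fst z) (snd z))\<^sup>2)) *\<^sub>R
        tricomi \<phi> (char_x (fst z) (snd z), char_y (fst z) (snd z)))"
      using cw0 by (intro continuous_intros cP cont cwc) auto
    then show ?thesis
      unfolding J_def[abs_def] box_real(2)[symmetric]
      by (intro integral_continuous_on_param) (simp add: case_prod_unfold)
  qed
  have "set_integrable lborel {a..R} J"
    unfolding set_integrable_def by (rule borel_integrable_compact[OF compact_Icc J_cont])
  then have Jint: "set_integrable lborel {a<..<R} J"
    by (rule set_integrable_subset) auto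
  have "(\<integral>z. E_I b z *\<^sub>R tricomi \<phi> z \<partial>lborel) = (LINT p:{a<..<R}|lborel. J p)"
    unfolding set_lebesgue_integral_def slice[symmetric]
    by (rule integral_lborel_shear[OF char_time_measurable int])
  also have "\<dots> = integral {a..R} J"
    using set_borel_integral_eq_integral(2)[OF Jint] by (simp add: integral_open_interval_real)
  also have "integral {a..R} J = integral {a..R} (\<lambda>p. integral {a..R} (\<lambda>q. riemann a p q *\<^sub>R pull_pq \<phi> p q +
       (riemann a p q / (6 * (p + q))) *\<^sub>R (pull_p \<phi> p q + pull_q \<phi> p q)))"
    unfolding J_def using a by (intro integral_cong tricomi_characteristic[symmetric]) auto
  also have "\<dots> = pull \<phi> a a"
  proof (rule riemann_identity[OF a less_imp_le[OF R], where \<Phi> = "pull \<phi>"])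
    fix p q assume "p \<in> {a..R}" "q \<in> {a..R}"
    then have s: "p + q > 0"
      using a by auto
    show "((\<lambda>p. pull \<phi> p q) has_vector_derivative pull_p \<phi> p q) (at p within {a..R})"
      "((\<lambda>q. pull \<phi> p q) has_vector_derivative pull_q \<phi> p q) (at q within {a..R})"
      "((\<lambda>q. pull_p \<phi> p q) has_vector_derivative pull_pq \<phi> p q) (at q within {a..R})"
      by (rule C_2_pull_has_derivatives[OF \<phi> s])+
  next
    show "pull \<phi> R q = 0" if "q \<in> {a..R}" for q
      unfolding pull_def using that R by (intro zero far) auto
    show "pull \<phi> p R = 0" if "p \<in> {a..R}" for p
      unfolding pull_def using that R by (intro zero far) auto
    show "pull_p \<phi> p R = 0" if "p \<in> {a..R}" for p
      unfolding pull_p_def using that R by (simp add: zero1 far)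
  qed (unfold case_prod_unfold pull_def pull_p_def pull_q_def pull_pq_def,
      (use cw0 in \<open>intro continuous_intros cP conts cwc; force\<close>)+)
  also have "pull \<phi> a a = \<phi> (0, b)"
  proof -
    have "char_w a a = ((- b) powr (3/2)) powr (1/3)"
      by (simp add: char_w_def a_def)
    then show ?thesis
      using b by (simp add: pull_def char_x_def char_y_def powr_powr powr_power)
  qed
  finally show ?thesis .
qed

theorem theorem3p1:
  fixes b :: real
  assumes "b < 0"
  shows "tricomi_fundamental_solution (E_I b) (0, b)"
  unfolding tricomi_fundamental_solution_def test_function_def
  using locally_integrable_E_I[OF assms] E_I_tricomi_integral[OF assms] by blast

end
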